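(* Let $I$ be a totally ordered set with a smallest element, and let $A$ be a Banach algebra with a right identity such that $\Delta(A)\neq\emptyset$. Then $UP(I,A)$ is approximately biprojective if and only if $I$ is a singleton and $A$ is approximately biprojective.
   Context: $\Delta(A)$ denotes the character space of a Banach algebra $A$, i.e. the set of all non-zero multiplicative linear functionals on $A$. A right identity of $A$ is an element $e\in A$ with $ae=a$ for all $a\in A$. For a Banach algebra $A$ and a non-empty totally ordered set $I$, $UP(I,A)$ is the set of all $I\times I$ upper triangular matrices $(a_{i,j})_{i,j\in I}$ with entries in $A$ (so $a_{i,j}=0$ unless $i\le j$) such that $\|(a_{i,j})\|=\sum_{i,j\in I}\|a_{i,j}\|<\infty$. With the usual matrix operations and this norm, $UP(I,A)$ is a Banach algebra. The projective tensor product $B\otimes_p B$ of a Banach algebra $B$ with itself is a Banach $B$-bimodule via $a\cdot(b\otimes c)=ab\otimes c$ and $(b\otimes c)\cdot a=b\otimes ca$, and $\pi_B:B\otimes_p B\to B$ is the bounded linear map determined by $\pi_B(a\otimes b)=ab$. A Banach algebra $B$ is approximately biprojective if there exists a net of continuous $B$-bimodule morphisms $\rho_\alpha:B\to B\otimes_p B$ (not assumed uniformly bounded) such that $\pi_B\circ\rho_\alpha(a)\to a$ for every $a\in B$. *)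

theory Defs
  imports "HOL-Analysis.Analysis" "HOL-Library.Poly_Mapping"
begin

section \<open>Complex Banach spaces and complex Banach algebras\<close>

class complex_vector = ab_group_add +
  fixes scaleC :: "complex \<Rightarrow> 'a \<Rightarrow> 'a"  (infixr \<open>*\<^sub>C\<close> 75)
  assumes scaleC_add_right: "a *\<^sub>C (x + y) = a *\<^sub>C x + a *\<^sub>C y"
    and scaleC_add_left: "(a + b) *\<^sub>C x = a *\<^sub>C x + b *\<^sub>C x"
    and scaleC_scaleC: "a *\<^sub>C b *\<^sub>C x = (a * b) *\<^sub>C x"
    and scaleC_one: "1 *\<^sub>C x = x"

class complex_normed_vector = complex_vector + real_normed_vector +
  assumes scaleR_scaleC: "r *\<^sub>R x = complex_of_real r *\<^sub>C x"
    and norm_scaleC: "norm (c *\<^sub>C x) = cmod c * norm x"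

class complex_banach = complex_normed_vector + banach

text \<open>No unit is required: \<^class>\<open>real_normed_algebra\<close> is the non-unital class.\<close>

class complex_banach_algebra = complex_banach + real_normed_algebra +
  assumes mult_scaleC_left: "(c *\<^sub>C x) * y = c *\<^sub>C (x * y)"
    and mult_scaleC_right: "x * (c *\<^sub>C y) = c *\<^sub>C (x * y)"

interpretation complex_vector: vector_space "scaleC :: complex \<Rightarrow> 'a \<Rightarrow> 'a::complex_vector"
  by unfold_locales (rule scaleC_add_right scaleC_add_left scaleC_scaleC scaleC_one)+

instantiation complex :: complex_banach_algebra
begin

definition scaleC_complex :: "complex \<Rightarrow> complex \<Rightarrow> complex"
  where "scaleC_complex = (*)"

instance
  by standard (simp_all add: scaleC_complex_def algebra_simps norm_mult scaleR_conv_of_real)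

end

abbreviation clinear :: "('a::complex_vector \<Rightarrow> 'b::complex_vector) \<Rightarrow> bool"
  where "clinear \<equiv> Vector_Spaces.linear scaleC scaleC"

lemma clinear_iff:
  "clinear f \<longleftrightarrow> (\<forall>x y. f (x + y) = f x + f y) \<and> (\<forall>c x. f (c *\<^sub>C x) = c *\<^sub>C f x)"
  unfolding Vector_Spaces.linear_iff by (simp add: complex_vector.vector_space_axioms)

lemma clinearD:
  assumes "clinear f"
  shows "f (x + y) = f x + f y" "f (c *\<^sub>C x) = c *\<^sub>C f x" "f 0 = 0" "f (- x) = - f x"
    "f (x - y) = f x - f y"
proof -
  interpret Vector_Spaces.linear scaleC scaleC f by fact
  show "f (x + y) = f x + f y" "f (c *\<^sub>C x) = c *\<^sub>C f x" "f 0 = 0" "f (- x) = - f x"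
    "f (x - y) = f x - f y"
    by (rule add scale zero neg diff)+
qed

definition bounded_clinear :: "('a::complex_normed_vector \<Rightarrow> 'b::complex_normed_vector) \<Rightarrow> bool"
  where "bounded_clinear f \<longleftrightarrow> clinear f \<and> bounded_linear f"

definition bounded_cbilinear ::
    "('a::complex_normed_vector \<Rightarrow> 'b::complex_normed_vector \<Rightarrow> 'c::complex_normed_vector) \<Rightarrow> bool"
  where "bounded_cbilinear f \<longleftrightarrow>
    (\<forall>x. clinear (f x)) \<and> (\<forall>y. clinear (\<lambda>x. f x y)) \<and> bounded_bilinear f"

lemma bounded_clinearI:
  assumes "clinear f" and "\<And>x. norm (f x) \<le> norm x * K"
  shows "bounded_clinear f"
  unfolding bounded_clinear_def
  by (intro conjI assms(1) bounded_linear_intro[where K = K] assms(2))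
     (simp_all add: clinearD[OF assms(1)] scaleR_scaleC)

lemma bounded_cbilinearI:
  assumes "\<And>x. clinear (f x)" "\<And>y. clinear (\<lambda>x. f x y)"
    and "\<And>x y. norm (f x y) \<le> norm x * norm y * K"
  shows "bounded_cbilinear f"
proof -
  have "bounded_bilinear f"
  proof
    show "\<exists>K. \<forall>a b. norm (f a b) \<le> norm a * norm b * K" using assms(3) by blast
  qed (simp_all add: scaleR_scaleC clinearD[OF assms(1)] clinearD[OF assms(2)])
  thus ?thesis using assms unfolding bounded_cbilinear_def by blast
qed


section \<open>The algebraic tensor product\<close>

instantiation poly_mapping :: (type, complex_vector) complex_vector
begin

lift_definition scaleC_poly_mapping :: "complex \<Rightarrow> ('a \<Rightarrow>\<^sub>0 'b) \<Rightarrow> ('a \<Rightarrow>\<^sub>0 'b)"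
  is "\<lambda>c f k. c *\<^sub>C f k"
proof -
  fix c and f :: "'a \<Rightarrow> 'b" assume "finite {k. f k \<noteq> 0}"
  thus "finite {k. c *\<^sub>C f k \<noteq> 0}" by (rule finite_subset[rotated]) auto
qed

instance
  by standard (transfer; simp add: fun_eq_iff scaleC_add_right scaleC_add_left scaleC_scaleC scaleC_one)+

end

definition free_pair :: "'a \<Rightarrow> 'b \<Rightarrow> ('a \<times> 'b \<Rightarrow>\<^sub>0 complex)"
  where "free_pair x y = Poly_Mapping.single (x, y) 1"

definition tensor_relators ::
    "('a::complex_vector \<times> 'b::complex_vector \<Rightarrow>\<^sub>0 complex) set"
  where "tensor_relators =
     {free_pair (x + x') y - free_pair x y - free_pair x' y | x x' y. True}
   \<union> {free_pair x (y + y') - free_pair x y - free_pair x y' | x y y'. True}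
   \<union> {free_pair (c *\<^sub>C x) y - c *\<^sub>C free_pair x y | c x y. True}
   \<union> {free_pair x (c *\<^sub>C y) - c *\<^sub>C free_pair x y | c x y. True}"

definition tensor_eq ::
    "('a::complex_vector \<times> 'b::complex_vector \<Rightarrow>\<^sub>0 complex) \<Rightarrow>
     ('a \<times> 'b \<Rightarrow>\<^sub>0 complex) \<Rightarrow> bool"
  where "tensor_eq u v \<longleftrightarrow> u - v \<in> complex_vector.span tensor_relators"

quotient_type (overloaded) ('a, 'b) tensor =
    "('a::complex_vector \<times> 'b::complex_vector) \<Rightarrow>\<^sub>0 complex" / tensor_eq
proof (rule equivpI)
  show "reflp (tensor_eq :: ('a \<times> 'b \<Rightarrow>\<^sub>0 complex) \<Rightarrow> _)"
    by (simp add: reflp_def tensor_eq_def complex_vector.span_zero)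
  show "symp (tensor_eq :: ('a \<times> 'b \<Rightarrow>\<^sub>0 complex) \<Rightarrow> _)"
    unfolding symp_def tensor_eq_def using complex_vector.span_neg by fastforce
  show "transp (tensor_eq :: ('a \<times> 'b \<Rightarrow>\<^sub>0 complex) \<Rightarrow> _)"
    unfolding transp_def tensor_eq_def
  proof (intro allI impI)
    fix u v w :: "'a \<times> 'b \<Rightarrow>\<^sub>0 complex"
    assume "u - v \<in> complex_vector.span tensor_relators" "v - w \<in> complex_vector.span tensor_relators"
    from complex_vector.span_add[OF this] show "u - w \<in> complex_vector.span tensor_relators" by simp
  qed
qed

instantiation tensor :: (complex_vector, complex_vector) complex_vector
begin

lift_definition zero_tensor :: "('a, 'b) tensor" is 0 .

lift_definition plus_tensor :: "('a, 'b) tensor \<Rightarrow> ('a, 'b) tensor \<Rightarrow> ('a, 'b) tensor" is "(+)"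
  unfolding tensor_eq_def add_diff_add by (rule complex_vector.span_add)

lift_definition uminus_tensor :: "('a, 'b) tensor \<Rightarrow> ('a, 'b) tensor" is uminus
  unfolding tensor_eq_def minus_diff_minus by (rule complex_vector.span_neg)

lift_definition minus_tensor :: "('a, 'b) tensor \<Rightarrow> ('a, 'b) tensor \<Rightarrow> ('a, 'b) tensor" is "(-)"
proof -
  fix a b c d :: "'a \<times> 'b \<Rightarrow>\<^sub>0 complex"
  assume "tensor_eq a b" "tensor_eq c d"
  hence "(a - b) - (c - d) \<in> complex_vector.span tensor_relators"
    unfolding tensor_eq_def by (rule complex_vector.span_diff)
  also have "(a - b) - (c - d) = (a - c) - (b - d)" by simp
  finally show "tensor_eq (a - c) (b - d)" unfolding tensor_eq_def .
qed

lift_definition scaleC_tensor :: "complex \<Rightarrow> ('a, 'b) tensor \<Rightarrow> ('a, 'b) tensor" is scaleC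
  unfolding tensor_eq_def complex_vector.scale_right_diff_distrib[symmetric] by (rule complex_vector.span_scale)

instance
proof
  have eq: "tensor_eq u v" if "u = v" for u v :: "'a \<times> 'b \<Rightarrow>\<^sub>0 complex"
    unfolding that tensor_eq_def by (simp add: complex_vector.span_zero)
  fix a b c :: "('a, 'b) tensor" and r s :: complex
  show "a + b + c = a + (b + c)" by transfer (rule eq, simp add: algebra_simps)
  show "a + b = b + a" by transfer (rule eq, simp add: algebra_simps)
  show "0 + a = a" by transfer (rule eq, simp)
  show "- a + a = 0" by transfer (rule eq, simp)
  show "a - b = a + - b" by transfer (rule eq, simp)
  show "r *\<^sub>C (a + b) = r *\<^sub>C a + r *\<^sub>C b" by transfer (rule eq, rule scaleC_add_right)
  show "(r + s) *\<^sub>C a = r *\<^sub>C a + s *\<^sub>C a" by transfer (rule eq, rule scaleC_add_left)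
  show "r *\<^sub>C s *\<^sub>C a = (r * s) *\<^sub>C a" by transfer (rule eq, rule scaleC_scaleC)
  show "1 *\<^sub>C a = a" by transfer (rule eq, rule scaleC_one)
qed

end

lift_definition tensor :: "'a::complex_vector \<Rightarrow> 'b::complex_vector \<Rightarrow> ('a, 'b) tensor"
  is free_pair .

lemma tensor_bilinear:
  "tensor (x + x') y = tensor x y + tensor x' y"
  "tensor x (y + y') = tensor x y + tensor x y'"
  "tensor (c *\<^sub>C x) y = c *\<^sub>C tensor x y"
  "tensor x (c *\<^sub>C y) = c *\<^sub>C tensor x y"
proof -
  show "tensor (x + x') y = tensor x y + tensor x' y"
    by transfer (unfold tensor_eq_def diff_diff_eq[symmetric], rule complex_vector.span_base,
        unfold tensor_relators_def, blast)
  show "tensor x (y + y') = tensor x y + tensor x y'"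
    by transfer (unfold tensor_eq_def diff_diff_eq[symmetric], rule complex_vector.span_base,
        unfold tensor_relators_def, blast)
  show "tensor (c *\<^sub>C x) y = c *\<^sub>C tensor x y"
    by transfer (unfold tensor_eq_def, rule complex_vector.span_base,
        unfold tensor_relators_def, blast)
  show "tensor x (c *\<^sub>C y) = c *\<^sub>C tensor x y"
    by transfer (unfold tensor_eq_def, rule complex_vector.span_base,
        unfold tensor_relators_def, blast)
qed

lemma free_expansion:
  "u = (\<Sum>k\<in>Poly_Mapping.keys u. Poly_Mapping.lookup u k *\<^sub>C free_pair (fst k) (snd k))"
proof (rule poly_mapping_eqI)
  fix k
  have "Poly_Mapping.lookup (Poly_Mapping.lookup u j *\<^sub>C free_pair (fst j) (snd j)) k =
      (if j = k then Poly_Mapping.lookup u k else 0)" for j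
    by (simp add: scaleC_poly_mapping.rep_eq free_pair_def lookup_single when_def scaleC_complex_def)
  hence "Poly_Mapping.lookup (\<Sum>j\<in>Poly_Mapping.keys u. Poly_Mapping.lookup u j *\<^sub>C free_pair (fst j) (snd j)) k
     = (\<Sum>j\<in>Poly_Mapping.keys u. if j = k then Poly_Mapping.lookup u k else 0)"
    by (simp only: lookup_sum)
  also have "\<dots> = Poly_Mapping.lookup u k"
    by (simp add: in_keys_iff)
  finally show "Poly_Mapping.lookup u k =
     Poly_Mapping.lookup (\<Sum>j\<in>Poly_Mapping.keys u. Poly_Mapping.lookup u j *\<^sub>C free_pair (fst j) (snd j)) k" ..
qed

lemma free_induct [case_names zero add]:
  fixes u :: "'a \<times> 'b \<Rightarrow>\<^sub>0 complex"
  assumes "P 0" and "\<And>c x y u. P u \<Longrightarrow> P (c *\<^sub>C free_pair x y + u)"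
  shows "P u"
proof -
  have "P (\<Sum>k\<in>K. f k *\<^sub>C free_pair (fst k) (snd k))" if "finite K" for K and f :: "_ \<Rightarrow> complex"
    using that by (induction K rule: finite_induct) (auto intro: assms)
  from this[where K = "Poly_Mapping.keys u" and f = "Poly_Mapping.lookup u"] show ?thesis
    unfolding free_expansion[of u, symmetric] by simp
qed

lemma tensor_induct [case_names zero add]:
  assumes "P 0" and "\<And>x y t. P t \<Longrightarrow> P (tensor x y + t)"
  shows "P t"
proof -
  have "P (abs_tensor u)" for u
  proof (induction u rule: free_induct)
    case zero
    then show ?case using assms(1) by (simp add: zero_tensor_def)
  next
    case (add c x y u)
    have "abs_tensor (c *\<^sub>C free_pair x y + u) = tensor (c *\<^sub>C x) y + abs_tensor u"
      by (simp only: tensor_bilinear plus_tensor.abs_eq[symmetric] scaleC_tensor.abs_eq[symmetric] tensor.abs_eq[symmetric])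
    then show ?case using add assms(2) by simp
  qed
  thus ?thesis by (induction t rule: tensor.abs_induct)
qed

definition free_lift :: "('a \<Rightarrow> 'b \<Rightarrow> 'c::complex_vector) \<Rightarrow> ('a \<times> 'b \<Rightarrow>\<^sub>0 complex) \<Rightarrow> 'c"
  where "free_lift f u = (\<Sum>k\<in>Poly_Mapping.keys u. Poly_Mapping.lookup u k *\<^sub>C f (fst k) (snd k))"

lemma free_lift_superset:
  assumes "finite K" "Poly_Mapping.keys u \<subseteq> K"
  shows "free_lift f u = (\<Sum>k\<in>K. Poly_Mapping.lookup u k *\<^sub>C f (fst k) (snd k))"
  unfolding free_lift_def
  by (rule sum.mono_neutral_left) (use assms in \<open>auto simp: in_keys_iff\<close>)

lemma free_lift_linear: "clinear (free_lift f)"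
  unfolding clinear_iff
proof (intro conjI allI)
  fix u v :: "'a \<times> 'b \<Rightarrow>\<^sub>0 complex" and c
  let ?K = "Poly_Mapping.keys u \<union> Poly_Mapping.keys v"
  have "free_lift f w = (\<Sum>k\<in>?K. Poly_Mapping.lookup w k *\<^sub>C f (fst k) (snd k))"
    if "w \<in> {u, v, u + v}" for w
    using that keys_add[of u v] by (intro free_lift_superset) auto
  thus "free_lift f (u + v) = free_lift f u + free_lift f v"
    by (simp add: lookup_add scaleC_add_left sum.distrib)
  have "free_lift f (c *\<^sub>C u) =
      (\<Sum>k\<in>Poly_Mapping.keys u. Poly_Mapping.lookup (c *\<^sub>C u) k *\<^sub>C f (fst k) (snd k))"
    by (intro free_lift_superset) (auto simp: in_keys_iff scaleC_poly_mapping.rep_eq)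
  thus "free_lift f (c *\<^sub>C u) = c *\<^sub>C free_lift f u"
    by (simp add: free_lift_def scaleC_poly_mapping.rep_eq complex_vector.scale_sum_right
        scaleC_complex_def)
qed

lemma free_lift_pair [simp]: "free_lift f (free_pair x y) = f x y"
  by (simp add: free_lift_def free_pair_def scaleC_one)

lemma tensor_universal:
  fixes f :: "'a::complex_vector \<Rightarrow> 'b::complex_vector \<Rightarrow> 'c::complex_vector"
  assumes "\<And>x. clinear (f x)" "\<And>y. clinear (\<lambda>x. f x y)"
  obtains g where "clinear g" "\<And>x y. g (tensor x y) = f x y"
proof -
  note L = clinearD[OF free_lift_linear[of f]]
  have "complex_vector.span tensor_relators \<subseteq> {u. free_lift f u = 0}"
  proof (rule complex_vector.span_minimal)
    show "tensor_relators \<subseteq> {u. free_lift f u = 0}"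
      unfolding tensor_relators_def
      by (auto simp: L clinearD[OF assms(1)] clinearD[OF assms(2)])
    show "complex_vector.subspace {u. free_lift f u = 0}"
      by (auto simp: complex_vector.subspace_def L)
  qed
  hence eq: "free_lift f u = free_lift f v" if "tensor_eq u v" for u v
    using that unfolding tensor_eq_def by (auto simp: L)
  define g where "g t = free_lift f (rep_tensor t)" for t
  have g: "g (abs_tensor u) = free_lift f u" for u
    unfolding g_def by (rule eq) (rule Quotient3_rep_abs[OF Quotient3_tensor], simp_all add: tensor_eq_def complex_vector.span_zero)
  show thesis
  proof (rule that[of g])
    show "clinear g"
      unfolding clinear_iff
    proof (intro conjI allI)
      fix s t :: "('a, 'b) tensor" and c
      obtain u v where "s = abs_tensor u" "t = abs_tensor v"
        by (induction s rule: tensor.abs_induct, induction t rule: tensor.abs_induct) blast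
      thus "g (s + t) = g s + g t" "g (c *\<^sub>C s) = c *\<^sub>C g s"
        by (simp_all add: plus_tensor.abs_eq scaleC_tensor.abs_eq g L)
    qed
    show "g (tensor x y) = f x y" for x y by (simp add: tensor.abs_eq g)
  qed
qed


section \<open>The projective tensor product\<close>

definition projective_norm ::
    "('a::complex_normed_vector, 'b::complex_normed_vector) tensor \<Rightarrow> real"
  where "projective_norm t =
    Inf {(\<Sum>(x, y)\<leftarrow>xs. norm x * norm y) | xs. t = (\<Sum>(x, y)\<leftarrow>xs. tensor x y)}"

lemma tensor_representation:
  "\<exists>xs. t = (\<Sum>(x, y)\<leftarrow>xs. tensor x y)"
proof (induction t rule: tensor_induct)
  case zero
  show ?case by (rule exI[of _ "[]"]) simp
next
  case (add x y t)
  then obtain xs where "t = (\<Sum>(x, y)\<leftarrow>xs. tensor x y)" by blast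
  thus ?case by (intro exI[of _ "(x, y) # xs"]) simp
qed

lemma sum_list_norms_nonneg: "0 \<le> (\<Sum>(x, y)\<leftarrow>xs. norm x * norm y)"
  by (induction xs) auto

lemma projective_norm_le:
  assumes "t = (\<Sum>(x, y)\<leftarrow>xs. tensor x y)"
  shows "projective_norm t \<le> (\<Sum>(x, y)\<leftarrow>xs. norm x * norm y)"
  unfolding projective_norm_def
  by (rule cInf_lower) (use assms sum_list_norms_nonneg in \<open>auto intro!: bdd_belowI[of _ 0]\<close>)

lemma projective_norm_nonneg: "0 \<le> projective_norm t"
  unfolding projective_norm_def
  by (rule cInf_greatest) (use tensor_representation[of t] sum_list_norms_nonneg in auto)

lemma projective_norm_approx:
  assumes "0 < e"
  obtains xs where "t = (\<Sum>(x, y)\<leftarrow>xs. tensor x y)"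
    "(\<Sum>(x, y)\<leftarrow>xs. norm x * norm y) < projective_norm t + e"
proof -
  let ?S = "{(\<Sum>(x, y)\<leftarrow>xs. norm x * norm y) | xs. t = (\<Sum>(x, y)\<leftarrow>xs. tensor x y)}"
  have "?S \<noteq> {}" using tensor_representation[of t] by auto
  moreover have "Inf ?S < projective_norm t + e"
    using assms by (simp add: projective_norm_def)
  ultimately obtain r where "r \<in> ?S" "r < projective_norm t + e"
    by (rule cInf_lessD[THEN bexE])
  thus thesis using that by blast
qed

lemma projective_norm_tensor_le: "projective_norm (tensor x y) \<le> norm x * norm y"
  using projective_norm_le[of "tensor x y" "[(x, y)]"] by simp

lemma projective_norm_zero [simp]: "projective_norm 0 = 0"
  by (rule antisym[OF order_trans[OF projective_norm_le[where xs = "[]"]] projective_norm_nonneg]) simp_all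

lemma projective_norm_add: "projective_norm (s + t) \<le> projective_norm s + projective_norm t"
proof (rule field_le_epsilon)
  fix e :: real assume "0 < e"
  hence e: "0 < e / 2" by simp
  obtain xs where xs: "s = (\<Sum>(x, y)\<leftarrow>xs. tensor x y)"
      "(\<Sum>(x, y)\<leftarrow>xs. norm x * norm y) < projective_norm s + e / 2"
    by (rule projective_norm_approx[OF e])
  obtain ys where ys: "t = (\<Sum>(x, y)\<leftarrow>ys. tensor x y)"
      "(\<Sum>(x, y)\<leftarrow>ys. norm x * norm y) < projective_norm t + e / 2"
    by (rule projective_norm_approx[OF e])
  have "projective_norm (s + t) \<le> (\<Sum>(x, y)\<leftarrow>xs @ ys. norm x * norm y)"
    by (rule projective_norm_le) (simp add: xs ys)
  thus "projective_norm (s + t) \<le> projective_norm s + projective_norm t + e"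
    using xs ys by simp
qed

lemma projective_norm_scaleC_le: "projective_norm (c *\<^sub>C t) \<le> cmod c * projective_norm t"
proof -
  have "projective_norm (c *\<^sub>C t) \<le> cmod c * (projective_norm t + e)" if "0 < e" for e
  proof -
    obtain xs where xs: "t = (\<Sum>(x, y)\<leftarrow>xs. tensor x y)"
        "(\<Sum>(x, y)\<leftarrow>xs. norm x * norm y) < projective_norm t + e"
      by (rule projective_norm_approx[OF \<open>0 < e\<close>])
    let ?ys = "map (\<lambda>(x, y). (c *\<^sub>C x, y)) xs"
    have 1: "c *\<^sub>C (\<Sum>(x, y)\<leftarrow>xs. tensor x y) = (\<Sum>(x, y)\<leftarrow>?ys. tensor x y)"
      by (induction xs) (auto simp: tensor_bilinear scaleC_add_right)
    have 2: "(\<Sum>(x, y)\<leftarrow>?ys. norm x * norm y) = cmod c * (\<Sum>(x, y)\<leftarrow>xs. norm x * norm y)"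
      by (induction xs) (auto simp: norm_scaleC algebra_simps)
    have "projective_norm (c *\<^sub>C t) \<le> (\<Sum>(x, y)\<leftarrow>?ys. norm x * norm y)"
      by (rule projective_norm_le) (simp only: 1[symmetric] xs(1)[symmetric])
    also have "\<dots> \<le> cmod c * (projective_norm t + e)"
      unfolding 2 using xs(2) by (intro mult_left_mono) auto
    finally show ?thesis .
  qed
  note * = this
  have "((\<lambda>e. cmod c * (projective_norm t + e)) \<longlongrightarrow> cmod c * (projective_norm t + 0)) (at_right 0)"
    by (intro tendsto_intros)
  from tendsto_lowerbound[OF this, of "projective_norm (c *\<^sub>C t)"] show ?thesis
    using * by (simp add: eventually_at_right_less eventually_at_filter)
qed

lemma projective_norm_scaleC: "projective_norm (c *\<^sub>C t) = cmod c * projective_norm t"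
proof (cases "c = 0")
  case False
  have "cmod c * projective_norm t = cmod c * projective_norm (inverse c *\<^sub>C c *\<^sub>C t)"
    using False by (simp add: scaleC_scaleC scaleC_one)
  also have "\<dots> \<le> cmod c * (cmod (inverse c) * projective_norm (c *\<^sub>C t))"
    by (intro mult_left_mono projective_norm_scaleC_le) auto
  also have "\<dots> = projective_norm (c *\<^sub>C t)" using False by (simp add: norm_inverse)
  finally show ?thesis using projective_norm_scaleC_le[of c t] by simp
qed simp

lemma projective_norm_minus: "projective_norm (- t) = projective_norm t"
  using projective_norm_scaleC[of "-1" t]
  by (simp add: complex_vector.scale_minus_left scaleC_one)

lemma projective_norm_diff: "projective_norm (s - t) \<le> projective_norm s + projective_norm t"
  using projective_norm_add[of s "- t"] by (simp add: projective_norm_minus)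

lemma projective_norm_commute: "projective_norm (s - t) = projective_norm (t - s)"
  using projective_norm_minus[of "s - t"] by simp

lemma projective_norm_reverse: "\<bar>projective_norm s - projective_norm t\<bar> \<le> projective_norm (s - t)"
  using projective_norm_add[of "s - t" t] projective_norm_add[of "t - s" s]
    projective_norm_commute[of s t] by simp

definition projective_Cauchy ::
    "(nat \<Rightarrow> ('a::complex_normed_vector, 'b::complex_normed_vector) tensor) \<Rightarrow> bool"
  where "projective_Cauchy s \<longleftrightarrow>
    (\<forall>e>0. \<exists>N. \<forall>m\<ge>N. \<forall>n\<ge>N. projective_norm (s m - s n) < e)"

definition ptensor_eq ::
    "(nat \<Rightarrow> ('a::complex_normed_vector, 'b::complex_normed_vector) tensor) \<Rightarrow>
     (nat \<Rightarrow> ('a, 'b) tensor) \<Rightarrow> bool"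
  where "ptensor_eq s t \<longleftrightarrow> projective_Cauchy s \<and> projective_Cauchy t \<and>
    (\<lambda>n. projective_norm (s n - t n)) \<longlonglongrightarrow> 0"

lemma projective_Cauchy_const [simp]: "projective_Cauchy (\<lambda>_. t)"
  by (simp add: projective_Cauchy_def)

lemma projective_Cauchy_add:
  assumes "projective_Cauchy s" "projective_Cauchy t"
  shows "projective_Cauchy (\<lambda>n. s n + t n)"
  unfolding projective_Cauchy_def
proof (intro allI impI)
  fix e :: real assume "0 < e"
  hence e: "0 < e / 2" by simp
  obtain M where M: "\<And>m n. m \<ge> M \<Longrightarrow> n \<ge> M \<Longrightarrow> projective_norm (s m - s n) < e / 2"
    using assms(1) e unfolding projective_Cauchy_def by blast
  obtain N where N: "\<And>m n. m \<ge> N \<Longrightarrow> n \<ge> N \<Longrightarrow> projective_norm (t m - t n) < e / 2"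
    using assms(2) e unfolding projective_Cauchy_def by blast
  show "\<exists>N. \<forall>m\<ge>N. \<forall>n\<ge>N. projective_norm (s m + t m - (s n + t n)) < e"
  proof (intro exI[of _ "max M N"] allI impI)
    fix m n assume "max M N \<le> m" "max M N \<le> n"
    hence "projective_norm (s m - s n) < e / 2" "projective_norm (t m - t n) < e / 2"
      using M N by auto
    thus "projective_norm (s m + t m - (s n + t n)) < e"
      using projective_norm_add[of "s m - s n" "t m - t n"] by (simp add: add_diff_add)
  qed
qed

lemma projective_Cauchy_scaleC:
  assumes "projective_Cauchy s"
  shows "projective_Cauchy (\<lambda>n. c *\<^sub>C s n)"
proof (cases "c = 0")
  case False
  show ?thesis
    unfolding projective_Cauchy_def
  proof (intro allI impI)
    fix e :: real assume "0 < e"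
    hence "0 < e / cmod c" using False by simp
    then obtain N where "\<And>m n. m \<ge> N \<Longrightarrow> n \<ge> N \<Longrightarrow> projective_norm (s m - s n) < e / cmod c"
      using assms unfolding projective_Cauchy_def by blast
    hence "cmod c * projective_norm (s m - s n) < e" if "m \<ge> N" "n \<ge> N" for m n
      using False that by (simp add: pos_less_divide_eq mult.commute)
    thus "\<exists>N. \<forall>m\<ge>N. \<forall>n\<ge>N. projective_norm (c *\<^sub>C s m - c *\<^sub>C s n) < e"
      unfolding complex_vector.scale_right_diff_distrib[symmetric] projective_norm_scaleC by blast
  qed
qed simp

lemma projective_Cauchy_minus:
  "projective_Cauchy s \<Longrightarrow> projective_Cauchy (\<lambda>n. - s n)"
  using projective_Cauchy_scaleC[of s "-1"]
  by (simp add: complex_vector.scale_minus_left scaleC_one)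

lemma projective_Cauchy_diff:
  "projective_Cauchy s \<Longrightarrow> projective_Cauchy t \<Longrightarrow> projective_Cauchy (\<lambda>n. s n - t n)"
  using projective_Cauchy_add[of s "\<lambda>n. - t n"] projective_Cauchy_minus[of t] by simp

lemma projective_Cauchy_norm:
  assumes "projective_Cauchy s"
  shows "convergent (\<lambda>n. projective_norm (s n))"
proof (rule Cauchy_convergent, rule CauchyI)
  fix e :: real assume "0 < e"
  then obtain N where "\<And>m n. m \<ge> N \<Longrightarrow> n \<ge> N \<Longrightarrow> projective_norm (s m - s n) < e"
    using assms unfolding projective_Cauchy_def by blast
  thus "\<exists>M. \<forall>m\<ge>M. \<forall>n\<ge>M. norm (projective_norm (s m) - projective_norm (s n)) < e"
    by (intro exI[of _ N] allI impI)
       (simp, rule le_less_trans[OF projective_norm_reverse], blast)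
qed

lemma projective_null_le:
  assumes "(\<lambda>n. projective_norm (s n)) \<longlonglongrightarrow> 0" "\<And>n. projective_norm (t n) \<le> K * projective_norm (s n)"
  shows "(\<lambda>n. projective_norm (t n)) \<longlonglongrightarrow> 0"
proof (rule tendsto_sandwich[OF _ _ tendsto_const])
  show "(\<lambda>n. K * projective_norm (s n)) \<longlonglongrightarrow> 0"
    using tendsto_mult_left[OF assms(1), of K] by simp
qed (use assms projective_norm_nonneg in \<open>auto intro!: always_eventually\<close>)

lemma projective_null_add:
  assumes "(\<lambda>n. projective_norm (s n)) \<longlonglongrightarrow> 0" "(\<lambda>n. projective_norm (t n)) \<longlonglongrightarrow> 0"
  shows "(\<lambda>n. projective_norm (s n + t n)) \<longlonglongrightarrow> 0"
proof (rule tendsto_sandwich[OF _ _ tendsto_const])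
  show "(\<lambda>n. projective_norm (s n) + projective_norm (t n)) \<longlonglongrightarrow> 0"
    using tendsto_add[OF assms] by simp
qed (use projective_norm_add projective_norm_nonneg in \<open>auto intro!: always_eventually\<close>)

lemma ptensor_eq_refl: "projective_Cauchy s \<Longrightarrow> ptensor_eq s s"
  by (simp add: ptensor_eq_def)

text \<open>The completion of the algebraic tensor product for the projective norm, by Cauchy
  sequences modulo null sequences.\<close>

quotient_type (overloaded) ('a, 'b) ptensor =
    "nat \<Rightarrow> ('a::complex_normed_vector, 'b::complex_normed_vector) tensor" / partial: ptensor_eq
proof (rule part_equivpI)
  show "\<exists>s :: nat \<Rightarrow> ('a, 'b) tensor. ptensor_eq s s"
    using ptensor_eq_refl[OF projective_Cauchy_const] by blast
  show "symp (ptensor_eq :: (nat \<Rightarrow> ('a, 'b) tensor) \<Rightarrow> _)"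
  proof (unfold symp_def ptensor_eq_def, intro allI impI)
    fix s t :: "nat \<Rightarrow> ('a, 'b) tensor"
    have "(\<lambda>n. projective_norm (t n - s n)) = (\<lambda>n. projective_norm (s n - t n))"
      by (rule ext) (rule projective_norm_commute)
    moreover assume "projective_Cauchy s \<and> projective_Cauchy t \<and>
      (\<lambda>n. projective_norm (s n - t n)) \<longlonglongrightarrow> 0"
    ultimately show "projective_Cauchy t \<and> projective_Cauchy s \<and>
      (\<lambda>n. projective_norm (t n - s n)) \<longlonglongrightarrow> 0" by simp
  qed
  show "transp (ptensor_eq :: (nat \<Rightarrow> ('a, 'b) tensor) \<Rightarrow> _)"
    unfolding transp_def
  proof (intro allI impI)
    fix s t u :: "nat \<Rightarrow> ('a, 'b) tensor"
    assume "ptensor_eq s t" "ptensor_eq t u"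
    thus "ptensor_eq s u"
      using projective_null_add[of "\<lambda>n. s n - t n" "\<lambda>n. t n - u n"] by (simp add: ptensor_eq_def)
  qed
qed

instantiation ptensor :: (complex_normed_vector, complex_normed_vector) complex_vector
begin

lift_definition zero_ptensor :: "('a, 'b) ptensor" is "\<lambda>_. 0"
  by (rule ptensor_eq_refl) simp

lift_definition plus_ptensor :: "('a, 'b) ptensor \<Rightarrow> ('a, 'b) ptensor \<Rightarrow> ('a, 'b) ptensor"
  is "\<lambda>s t n. s n + t n"
  by (auto simp: ptensor_eq_def add_diff_add intro: projective_Cauchy_add projective_null_add)

lift_definition uminus_ptensor :: "('a, 'b) ptensor \<Rightarrow> ('a, 'b) ptensor"
  is "\<lambda>s n. - s n"
  unfolding ptensor_eq_def minus_diff_minus projective_norm_minus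
  by (blast intro: projective_Cauchy_minus)

lift_definition minus_ptensor :: "('a, 'b) ptensor \<Rightarrow> ('a, 'b) ptensor \<Rightarrow> ('a, 'b) ptensor"
  is "\<lambda>s t n. s n - t n"
proof -
  fix s s' t t' :: "nat \<Rightarrow> ('a, 'b) tensor"
  assume "ptensor_eq s s'" "ptensor_eq t t'"
  moreover have "s n - t n - (s' n - t' n) = (s n - s' n) + - (t n - t' n)" for n
    by simp
  ultimately show "ptensor_eq (\<lambda>n. s n - t n) (\<lambda>n. s' n - t' n)"
    using projective_null_add[of "\<lambda>n. s n - s' n" "\<lambda>n. - (t n - t' n)"]
    unfolding ptensor_eq_def by (simp only: projective_norm_minus projective_Cauchy_diff)
qed

lift_definition scaleC_ptensor :: "complex \<Rightarrow> ('a, 'b) ptensor \<Rightarrow> ('a, 'b) ptensor"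
  is "\<lambda>c s n. c *\<^sub>C s n"
  by (auto simp: ptensor_eq_def complex_vector.scale_right_diff_distrib[symmetric] projective_norm_scaleC
      intro!: projective_Cauchy_scaleC tendsto_mult_right_zero)

instance
proof
  fix a b c :: "('a, 'b) ptensor" and r s :: complex
  show "a + b + c = a + (b + c)"
    by transfer (auto simp: ptensor_eq_def algebra_simps intro!: projective_Cauchy_add)
  show "a + b = b + a"
    by transfer (auto simp: ptensor_eq_def algebra_simps intro!: projective_Cauchy_add)
  show "0 + a = a"
    by transfer (auto simp: ptensor_eq_def)
  show "- a + a = 0"
    by transfer (auto simp: ptensor_eq_def)
  show "a - b = a + - b"
    by transfer (auto simp: ptensor_eq_def intro!: projective_Cauchy_diff)
  show "r *\<^sub>C (a + b) = r *\<^sub>C a + r *\<^sub>C b"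
    by transfer (auto simp: ptensor_eq_def scaleC_add_right intro!: projective_Cauchy_add projective_Cauchy_scaleC)
  show "(r + s) *\<^sub>C a = r *\<^sub>C a + s *\<^sub>C a"
    by transfer (auto simp: ptensor_eq_def scaleC_add_left intro!: projective_Cauchy_add projective_Cauchy_scaleC)
  show "r *\<^sub>C s *\<^sub>C a = (r * s) *\<^sub>C a"
    by transfer (auto simp: ptensor_eq_def scaleC_scaleC intro!: projective_Cauchy_scaleC)
  show "1 *\<^sub>C a = a"
    by transfer (auto simp: ptensor_eq_def scaleC_one)
qed

end

instantiation ptensor :: (complex_normed_vector, complex_normed_vector) real_vector
begin

definition scaleR_ptensor :: "real \<Rightarrow> ('a, 'b) ptensor \<Rightarrow> ('a, 'b) ptensor"
  where "scaleR_ptensor r t = complex_of_real r *\<^sub>C t"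

instance
  by standard (simp_all add: scaleR_ptensor_def scaleC_add_right scaleC_add_left scaleC_scaleC scaleC_one)

end

instantiation ptensor :: (complex_normed_vector, complex_normed_vector) real_normed_vector
begin

lift_definition norm_ptensor :: "('a, 'b) ptensor \<Rightarrow> real"
  is "\<lambda>s. lim (\<lambda>n. projective_norm (s n))"
proof -
  fix s t :: "nat \<Rightarrow> ('a, 'b) tensor"
  assume st: "ptensor_eq s t"
  hence "(\<lambda>n. projective_norm (s n)) \<longlonglongrightarrow> lim (\<lambda>n. projective_norm (s n))"
    by (simp add: ptensor_eq_def projective_Cauchy_norm convergent_LIMSEQ_iff[symmetric])
  moreover have "(\<lambda>n. projective_norm (s n) - projective_norm (t n)) \<longlonglongrightarrow> 0"
  proof (rule tendsto_rabs_zero_cancel, rule tendsto_sandwich[OF _ _ tendsto_const])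
    show "(\<lambda>n. projective_norm (s n - t n)) \<longlonglongrightarrow> 0" using st by (simp add: ptensor_eq_def)
  qed (use projective_norm_reverse in \<open>auto intro!: always_eventually\<close>)
  ultimately have "(\<lambda>n. projective_norm (s n) - (projective_norm (s n) - projective_norm (t n)))
      \<longlonglongrightarrow> lim (\<lambda>n. projective_norm (s n)) - 0"
    by (rule tendsto_diff)
  thus "lim (\<lambda>n. projective_norm (s n)) = lim (\<lambda>n. projective_norm (t n))"
    by (simp add: limI)
qed

definition sgn_ptensor :: "('a, 'b) ptensor \<Rightarrow> ('a, 'b) ptensor"
  where "sgn_ptensor x = x /\<^sub>R norm x"

definition dist_ptensor :: "('a, 'b) ptensor \<Rightarrow> ('a, 'b) ptensor \<Rightarrow> real"
  where "dist_ptensor x y = norm (x - y)"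

definition uniformity_ptensor :: "(('a, 'b) ptensor \<times> ('a, 'b) ptensor) filter"
  where [code del]: "uniformity_ptensor = (INF e\<in>{0<..}. principal {(x, y). dist x y < e})"

definition open_ptensor :: "('a, 'b) ptensor set \<Rightarrow> bool"
  where [code del]: "open_ptensor U \<longleftrightarrow> (\<forall>x\<in>U. eventually (\<lambda>(x', y). x' = x \<longrightarrow> y \<in> U) uniformity)"

lemma norm_ptensor_LIMSEQ:
  "projective_Cauchy s \<Longrightarrow> (\<lambda>n. projective_norm (s n)) \<longlonglongrightarrow> lim (\<lambda>n. projective_norm (s n))"
  by (simp add: projective_Cauchy_norm convergent_LIMSEQ_iff[symmetric])

lemma norm_scaleC_ptensor: "norm (r *\<^sub>C a) = cmod r * norm (a :: ('a, 'b) ptensor)"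
proof transfer
  fix r and s :: "nat \<Rightarrow> ('a, 'b) tensor" assume "ptensor_eq s s"
  hence s: "projective_Cauchy s" by (simp add: ptensor_eq_def)
  show "lim (\<lambda>n. projective_norm (r *\<^sub>C s n)) = cmod r * lim (\<lambda>n. projective_norm (s n))"
    by (rule limI) (simp add: projective_norm_scaleC tendsto_mult_left norm_ptensor_LIMSEQ[OF s])
qed

instance
proof
  fix a b :: "('a, 'b) ptensor" and p :: real
  show "sgn a = a /\<^sub>R norm a" by (rule sgn_ptensor_def)
  show "dist a b = norm (a - b)" by (rule dist_ptensor_def)
  show "uniformity = (INF e\<in>{0<..}. principal {(x :: ('a, 'b) ptensor, y). dist x y < e})"
    by (rule uniformity_ptensor_def)
  show "open U \<longleftrightarrow> (\<forall>x\<in>U. eventually (\<lambda>(x', y). x' = x \<longrightarrow> y \<in> U) uniformity)"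
    for U :: "('a, 'b) ptensor set" by (rule open_ptensor_def)
  show "norm a = 0 \<longleftrightarrow> a = 0"
  proof transfer
    fix s :: "nat \<Rightarrow> ('a, 'b) tensor" assume "ptensor_eq s s"
    hence s: "projective_Cauchy s" by (simp add: ptensor_eq_def)
    show "lim (\<lambda>n. projective_norm (s n)) = 0 \<longleftrightarrow> ptensor_eq s (\<lambda>_. 0)"
      using norm_ptensor_LIMSEQ[OF s] s by (auto simp: ptensor_eq_def dest: limI)
  qed
  show "norm (a + b) \<le> norm a + norm b"
  proof transfer
    fix s t :: "nat \<Rightarrow> ('a, 'b) tensor" assume "ptensor_eq s s" "ptensor_eq t t"
    hence s: "projective_Cauchy s" "projective_Cauchy t" by (simp_all add: ptensor_eq_def)
    note L = norm_ptensor_LIMSEQ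
    show "lim (\<lambda>n. projective_norm (s n + t n))
        \<le> lim (\<lambda>n. projective_norm (s n)) + lim (\<lambda>n. projective_norm (t n))"
      by (rule LIMSEQ_le[OF L[OF projective_Cauchy_add[OF s]] tendsto_add[OF L[OF s(1)] L[OF s(2)]]])
         (use projective_norm_add in auto)
  qed
  show "norm (p *\<^sub>R a) = \<bar>p\<bar> * norm a"
    by (simp add: scaleR_ptensor_def norm_scaleC_ptensor)
qed

end

instance ptensor :: (complex_normed_vector, complex_normed_vector) complex_normed_vector
  by standard (rule scaleR_ptensor_def norm_scaleC_ptensor)+

definition tensor_embed ::
    "('a::complex_normed_vector, 'b::complex_normed_vector) tensor \<Rightarrow> ('a, 'b) ptensor"
  where "tensor_embed t = abs_ptensor (\<lambda>_. t)"

lemma tensor_embed_linear: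
  "clinear (tensor_embed :: ('a::complex_normed_vector, 'b::complex_normed_vector) tensor \<Rightarrow> _)"
  by (simp add: clinear_iff tensor_embed_def plus_ptensor.abs_eq scaleC_ptensor.abs_eq ptensor_eq_refl)

lemma norm_tensor_embed: "norm (tensor_embed t) = projective_norm t"
  by (simp add: tensor_embed_def norm_ptensor.abs_eq ptensor_eq_refl)

lemma tensor_embed_LIMSEQ:
  assumes "projective_Cauchy s"
  shows "(\<lambda>n. tensor_embed (s n)) \<longlonglongrightarrow> abs_ptensor s"
proof (rule LIMSEQ_I)
  fix e :: real assume "0 < e"
  hence "0 < e / 2" by simp
  then obtain N where N: "\<And>m n. m \<ge> N \<Longrightarrow> n \<ge> N \<Longrightarrow> projective_norm (s m - s n) < e / 2"
    using assms unfolding projective_Cauchy_def by blast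
  have "norm (tensor_embed (s n) - abs_ptensor s) < e" if "n \<ge> N" for n
  proof -
    have C: "projective_Cauchy (\<lambda>m. s n - s m)"
      by (intro projective_Cauchy_diff projective_Cauchy_const assms)
    have "norm (tensor_embed (s n) - abs_ptensor s) = lim (\<lambda>m. projective_norm (s n - s m))"
      using assms C by (simp add: tensor_embed_def minus_ptensor.abs_eq norm_ptensor.abs_eq ptensor_eq_refl)
    also have "\<dots> \<le> e / 2"
    proof (rule LIMSEQ_le_const2)
      show "(\<lambda>m. projective_norm (s n - s m)) \<longlonglongrightarrow> lim (\<lambda>m. projective_norm (s n - s m))"
        using projective_Cauchy_norm[OF C] by (simp add: convergent_LIMSEQ_iff)
      show "\<exists>N. \<forall>m\<ge>N. projective_norm (s n - s m) \<le> e / 2"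
        using N that by (intro exI[of _ N]) (auto intro: less_imp_le)
    qed
    finally show ?thesis using \<open>0 < e\<close> by simp
  qed
  thus "\<exists>N. \<forall>n\<ge>N. norm (tensor_embed (s n) - abs_ptensor s) < e" by blast
qed

lemma ptensor_limit:
  obtains s where "projective_Cauchy s" "t = abs_ptensor s" "(\<lambda>n. tensor_embed (s n)) \<longlonglongrightarrow> t"
proof -
  have "\<exists>s. projective_Cauchy s \<and> t = abs_ptensor s"
    by (induction t rule: ptensor.abs_induct) (auto simp: ptensor_eq_def)
  thus thesis using that tensor_embed_LIMSEQ by blast
qed

instance ptensor :: (complex_normed_vector, complex_normed_vector) complex_banach
proof
  fix X :: "nat \<Rightarrow> ('a, 'b) ptensor"
  assume X: "Cauchy X"
  have "\<exists>t. norm (tensor_embed t - X n) < inverse (real (Suc n))" for n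
  proof -
    obtain s where "(\<lambda>k. tensor_embed (s k)) \<longlonglongrightarrow> X n" by (rule ptensor_limit)
    from LIMSEQ_D[OF this, of "inverse (real (Suc n))"] show ?thesis by auto
  qed
  then obtain t where t: "\<And>n. norm (tensor_embed (t n) - X n) < inverse (real (Suc n))" by metis
  have null: "(\<lambda>n. tensor_embed (t n) - X n) \<longlonglongrightarrow> 0"
    by (rule Lim_null_comparison[OF _ LIMSEQ_inverse_real_of_nat]) (use t in \<open>auto intro!: always_eventually less_imp_le\<close>)
  have "projective_Cauchy t"
    unfolding projective_Cauchy_def
  proof (intro allI impI)
    fix e :: real assume "0 < e"
    hence e: "0 < e / 3" by simp
    obtain M where M: "\<And>m n. m \<ge> M \<Longrightarrow> n \<ge> M \<Longrightarrow> norm (X m - X n) < e / 3"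
      using CauchyD[OF X e] by blast
    obtain N where N: "\<And>n. n \<ge> N \<Longrightarrow> norm (tensor_embed (t n) - X n) < e / 3"
      using LIMSEQ_D[OF null e] by auto
    show "\<exists>N. \<forall>m\<ge>N. \<forall>n\<ge>N. projective_norm (t m - t n) < e"
    proof (intro exI[of _ "max M N"] allI impI)
      fix m n assume "max M N \<le> m" "max M N \<le> n"
      hence *: "norm (X m - X n) < e / 3" "norm (tensor_embed (t m) - X m) < e / 3"
        "norm (tensor_embed (t n) - X n) < e / 3"
        using M N by auto
      have "projective_norm (t m - t n) = norm (tensor_embed (t m) - tensor_embed (t n))"
        by (simp add: norm_tensor_embed[symmetric] clinearD(5)[OF tensor_embed_linear])
      also have "tensor_embed (t m) - tensor_embed (t n) =
          (tensor_embed (t m) - X m) + (X m - X n) - (tensor_embed (t n) - X n)" by simp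
      also have "norm \<dots> < e"
        using * norm_triangle_ineq4[of "(tensor_embed (t m) - X m) + (X m - X n)" "tensor_embed (t n) - X n"]
          norm_triangle_ineq[of "tensor_embed (t m) - X m" "X m - X n"] by linarith
      finally show "projective_norm (t m - t n) < e" .
    qed
  qed
  from tendsto_diff[OF tensor_embed_LIMSEQ[OF this] null]
  show "convergent X" unfolding convergent_def by auto
qed

definition ptensor ::
    "'a::complex_normed_vector \<Rightarrow> 'b::complex_normed_vector \<Rightarrow> ('a, 'b) ptensor"  (infixr \<open>\<otimes>\<^sub>p\<close> 76)
  where "x \<otimes>\<^sub>p y = tensor_embed (tensor x y)"

lemma ptensor_bilinear:
  "(x + x') \<otimes>\<^sub>p y = x \<otimes>\<^sub>p y + x' \<otimes>\<^sub>p y"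
  "x \<otimes>\<^sub>p (y + y') = x \<otimes>\<^sub>p y + x \<otimes>\<^sub>p y'"
  "(c *\<^sub>C x) \<otimes>\<^sub>p y = c *\<^sub>C x \<otimes>\<^sub>p y"
  "x \<otimes>\<^sub>p (c *\<^sub>C y) = c *\<^sub>C x \<otimes>\<^sub>p y"
  by (simp_all add: ptensor_def tensor_bilinear clinearD[OF tensor_embed_linear])

lemma norm_ptensor_le: "norm (x \<otimes>\<^sub>p y) \<le> norm x * norm y"
  by (simp add: ptensor_def norm_tensor_embed projective_norm_tensor_le)

lemma bounded_cbilinear_ptensor: "bounded_cbilinear (\<otimes>\<^sub>p)"
  by (rule bounded_cbilinearI[where K = 1])
     (simp_all add: clinear_iff ptensor_bilinear norm_ptensor_le)

lemma bounded_clinear_ptensor_ext: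
  fixes g h :: "('a::complex_normed_vector, 'b::complex_normed_vector) ptensor \<Rightarrow> 'c::complex_normed_vector"
  assumes "bounded_clinear g" "bounded_clinear h" "\<And>x y. g (x \<otimes>\<^sub>p y) = h (x \<otimes>\<^sub>p y)"
  shows "g = h"
proof
  fix t :: "('a, 'b) ptensor"
  have g: "clinear g" "clinear h" "bounded_linear g" "bounded_linear h"
    using assms by (auto simp: bounded_clinear_def)
  have eq: "g (tensor_embed t) = h (tensor_embed t)" for t :: "('a, 'b) tensor"
    by (induction t rule: tensor_induct)
       (simp_all add: clinearD[OF tensor_embed_linear] clinearD[OF g(1)] clinearD[OF g(2)]
         assms(3)[unfolded ptensor_def])
  obtain s where s: "(\<lambda>n. tensor_embed (s n)) \<longlonglongrightarrow> t" by (rule ptensor_limit)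
  have "(\<lambda>n. g (tensor_embed (s n))) \<longlonglongrightarrow> g t" "(\<lambda>n. g (tensor_embed (s n))) \<longlonglongrightarrow> h t"
    using bounded_linear.tendsto[OF g(3) s] bounded_linear.tendsto[OF g(4) s] by (simp_all add: eq)
  thus "g t = h t" by (rule LIMSEQ_unique)
qed

lemma ptensor_universal_bound:
  fixes f :: "'a::complex_normed_vector \<Rightarrow> 'b::complex_normed_vector \<Rightarrow> 'c::complex_banach"
  assumes f: "bounded_cbilinear f" and K: "\<And>x y. norm (f x y) \<le> norm x * norm y * K"
    and K0: "0 \<le> K"
  obtains g where "bounded_clinear g" "\<And>x y. g (x \<otimes>\<^sub>p y) = f x y" "\<And>t. norm (g t) \<le> norm t * K"
proof -
  have lin: "clinear (f x)" "clinear (\<lambda>x. f x y)" for x y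
    using f by (auto simp: bounded_cbilinear_def)
  obtain g where g: "clinear g" "\<And>x y. g (tensor x y) = f x y"
    by (rule tensor_universal[of f, OF lin]) blast
  note G = clinearD[OF g(1)]
  have bound: "norm (g t) \<le> projective_norm t * K" for t
  proof -
    have "norm (g t) \<le> (projective_norm t + e) * K" if "0 < e" for e
    proof -
      obtain xs where xs: "t = (\<Sum>(x, y)\<leftarrow>xs. tensor x y)"
          "(\<Sum>(x, y)\<leftarrow>xs. norm x * norm y) < projective_norm t + e"
        by (rule projective_norm_approx[OF \<open>0 < e\<close>])
      have "norm (g (\<Sum>(x, y)\<leftarrow>xs. tensor x y)) \<le> (\<Sum>(x, y)\<leftarrow>xs. norm x * norm y) * K"
      proof (induction xs)
        case (Cons p xs)
        obtain x y where p: "p = (x, y)" by (cases p)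
        show ?case
          using Cons K[of x y] norm_triangle_ineq[of "f x y" "g (\<Sum>(x, y)\<leftarrow>xs. tensor x y)"]
          by (simp add: p G g(2) distrib_right)
      qed (simp add: G)
      also have "\<dots> \<le> (projective_norm t + e) * K"
        using xs(2) K0 by (intro mult_right_mono) auto
      finally show ?thesis by (simp add: xs(1))
    qed
    note * = this
    have "((\<lambda>e. (projective_norm t + e) * K) \<longlongrightarrow> (projective_norm t + 0) * K) (at_right 0)"
      by (intro tendsto_intros)
    from tendsto_lowerbound[OF this, of "norm (g t)"] show ?thesis
      using * by (simp add: eventually_at_filter)
  qed
  have conv: "convergent (\<lambda>n. g (s n))" if s: "projective_Cauchy s" for s
  proof (rule Cauchy_convergent, rule CauchyI)
    fix e :: real assume "0 < e"
    hence "0 < e / (K + 1)" using K0 by simp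
    then obtain N where N: "\<And>m n. m \<ge> N \<Longrightarrow> n \<ge> N \<Longrightarrow> projective_norm (s m - s n) < e / (K + 1)"
      using s unfolding projective_Cauchy_def by blast
    have "norm (g (s m) - g (s n)) < e" if "m \<ge> N" "n \<ge> N" for m n
    proof -
      have "norm (g (s m) - g (s n)) \<le> projective_norm (s m - s n) * (K + 1)"
        using bound[of "s m - s n"] projective_norm_nonneg[of "s m - s n"]
        by (simp add: G algebra_simps)
      also have "\<dots> < e" using N[OF that] K0 by (simp add: field_simps)
      finally show ?thesis .
    qed
    thus "\<exists>M. \<forall>m\<ge>M. \<forall>n\<ge>M. norm (g (s m) - g (s n)) < e" by blast
  qed
  define h where "h t = lim (\<lambda>n. g (rep_ptensor t n))" for t
  have h: "(\<lambda>n. g (s n)) \<longlonglongrightarrow> h (abs_ptensor s)" if s: "projective_Cauchy s" for s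
  proof -
    let ?r = "rep_ptensor (abs_ptensor s)"
    have "ptensor_eq ?r s"
      by (rule Quotient3_rep_abs[OF Quotient3_ptensor, OF ptensor_eq_refl[OF s]])
    hence r: "projective_Cauchy ?r" and null: "(\<lambda>n. projective_norm (?r n - s n)) \<longlonglongrightarrow> 0"
      by (auto simp: ptensor_eq_def)
    have "(\<lambda>n. g (?r n - s n)) \<longlonglongrightarrow> 0"
      by (rule Lim_null_comparison[OF _ tendsto_mult_left_zero[OF null, of K]]) (use bound in auto)
    moreover have "(\<lambda>n. g (?r n)) \<longlonglongrightarrow> h (abs_ptensor s)"
      using conv[OF r] by (simp add: h_def convergent_LIMSEQ_iff)
    ultimately have "(\<lambda>n. g (?r n) - g (?r n - s n)) \<longlonglongrightarrow> h (abs_ptensor s) - 0"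
      by (intro tendsto_diff)
    thus ?thesis by (simp add: G)
  qed
  have hK: "norm (h t) \<le> norm t * K" for t
  proof -
    obtain s where s: "projective_Cauchy s" "t = abs_ptensor s" "(\<lambda>n. tensor_embed (s n)) \<longlonglongrightarrow> t"
      by (rule ptensor_limit)
    have "(\<lambda>n. norm (g (s n))) \<longlonglongrightarrow> norm (h t)" using h[OF s(1)] s(2) by (intro tendsto_norm) simp
    moreover have "(\<lambda>n. norm (tensor_embed (s n)) * K) \<longlonglongrightarrow> norm t * K"
      by (intro tendsto_intros s(3))
    ultimately show ?thesis
      by (rule LIMSEQ_le) (use bound in \<open>auto simp: norm_tensor_embed\<close>)
  qed
  have hlin: "clinear h"
    unfolding clinear_iff
  proof (intro conjI allI)
    fix a b :: "('a, 'b) ptensor" and c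
    obtain s where s: "projective_Cauchy s" "a = abs_ptensor s" "(\<lambda>n. tensor_embed (s n)) \<longlonglongrightarrow> a"
      by (rule ptensor_limit)
    obtain t where t: "projective_Cauchy t" "b = abs_ptensor t" "(\<lambda>n. tensor_embed (t n)) \<longlonglongrightarrow> b"
      by (rule ptensor_limit)
    have "a + b = abs_ptensor (\<lambda>n. s n + t n)"
      using s t by (simp add: plus_ptensor.abs_eq ptensor_eq_refl)
    hence "(\<lambda>n. g (s n) + g (t n)) \<longlonglongrightarrow> h (a + b)"
      using h[OF projective_Cauchy_add[OF s(1) t(1)]] by (simp add: G)
    moreover have "(\<lambda>n. g (s n) + g (t n)) \<longlonglongrightarrow> h a + h b"
      using h[OF s(1)] h[OF t(1)] s t by (intro tendsto_add) simp_all
    ultimately show "h (a + b) = h a + h b" by (rule LIMSEQ_unique)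
    have "c *\<^sub>C a = abs_ptensor (\<lambda>n. c *\<^sub>C s n)"
      using s by (simp add: scaleC_ptensor.abs_eq ptensor_eq_refl)
    hence 1: "(\<lambda>n. c *\<^sub>C g (s n)) \<longlonglongrightarrow> h (c *\<^sub>C a)"
      using h[OF projective_Cauchy_scaleC[OF s(1), of c]] by (simp add: G)
    have "bounded_linear (\<lambda>x :: 'c. c *\<^sub>C x)"
      using bounded_clinearI[of "\<lambda>x :: 'c. c *\<^sub>C x" "cmod c"]
      by (simp add: bounded_clinear_def clinear_iff scaleC_add_right scaleC_scaleC norm_scaleC mult.commute)
    from bounded_linear.tendsto[OF this h[OF s(1)]]
    have "(\<lambda>n. c *\<^sub>C g (s n)) \<longlonglongrightarrow> c *\<^sub>C h a" by (simp add: s(2))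
    with 1 show "h (c *\<^sub>C a) = c *\<^sub>C h a" by (rule LIMSEQ_unique)
  qed
  have "h (x \<otimes>\<^sub>p y) = f x y" for x y
  proof -
    have "(\<lambda>n. f x y) \<longlonglongrightarrow> h (x \<otimes>\<^sub>p y)"
      using h[of "\<lambda>_. tensor x y"] by (simp add: g ptensor_def tensor_embed_def)
    thus ?thesis by (rule LIMSEQ_unique[OF _ tendsto_const])
  qed
  thus thesis using that[of h] hK bounded_clinearI[OF hlin hK] by blast
qed

text \<open>The bounded linear map determined by a bounded bilinear map on elementary tensors.\<close>

definition ptensor_lift ::
    "('a::complex_normed_vector \<Rightarrow> 'b::complex_normed_vector \<Rightarrow> 'c::complex_banach) \<Rightarrow>
     ('a, 'b) ptensor \<Rightarrow> 'c"
  where "ptensor_lift f = (THE g. bounded_clinear g \<and> (\<forall>x y. g (x \<otimes>\<^sub>p y) = f x y))"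

lemma ptensor_lift:
  assumes "bounded_cbilinear f"
  shows "bounded_clinear (ptensor_lift f)" and "ptensor_lift f (x \<otimes>\<^sub>p y) = f x y"
proof -
  obtain K where "0 \<le> K" "\<And>x y. norm (f x y) \<le> norm x * norm y * K"
    using assms bounded_bilinear.nonneg_bounded unfolding bounded_cbilinear_def by metis
  then obtain g where g: "bounded_clinear g" "\<And>x y. g (x \<otimes>\<^sub>p y) = f x y"
    using ptensor_universal_bound[OF assms] by metis
  have "\<exists>!g. bounded_clinear g \<and> (\<forall>x y. g (x \<otimes>\<^sub>p y) = f x y)"
  proof (rule ex1I[of _ g])
    show "h = g" if "bounded_clinear h \<and> (\<forall>x y. h (x \<otimes>\<^sub>p y) = f x y)" for h
      by (rule bounded_clinear_ptensor_ext) (use that g in simp_all)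
  qed (use g in blast)
  from theI'[OF this] show "bounded_clinear (ptensor_lift f)" "ptensor_lift f (x \<otimes>\<^sub>p y) = f x y"
    unfolding ptensor_lift_def by blast+
qed


section \<open>The Banach algebra of upper triangular matrices\<close>

text \<open>The index set \<open>I\<close> is the type \<^typ>\<open>'i\<close>. No countability is assumed.\<close>

definition upper_triangular :: "('i::linorder \<Rightarrow> 'i \<Rightarrow> 'a::real_normed_vector) \<Rightarrow> bool"
  where "upper_triangular m \<longleftrightarrow>
    (\<forall>i j. \<not> i \<le> j \<longrightarrow> m i j = 0) \<and> (\<lambda>(i, j). norm (m i j)) summable_on UNIV"

lemma summable_on_bounded_nonneg:
  fixes f :: "'a \<Rightarrow> real"
  assumes "\<And>x. 0 \<le> f x" "\<And>F. finite F \<Longrightarrow> F \<subseteq> A \<Longrightarrow> sum f F \<le> B"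
  shows "f summable_on A" "infsum f A \<le> B"
proof -
  show *: "f summable_on A"
    by (rule nonneg_bdd_above_summable_on) (use assms in \<open>auto intro!: bdd_aboveI[of _ B]\<close>)
  show "infsum f A \<le> B" by (rule infsum_le_finite_sums[OF * assms(2)])
qed

typedef (overloaded) ('i::linorder, 'a::real_normed_vector) UP =
    "{m :: 'i \<Rightarrow> 'i \<Rightarrow> 'a. upper_triangular m}"
  morphisms entry UP
  by (rule exI[of _ "\<lambda>_ _. 0"]) (simp add: upper_triangular_def split_def)

setup_lifting type_definition_UP

lemma entry_lower: "\<not> i \<le> j \<Longrightarrow> entry m i j = 0"
  using entry[of m] by (simp add: upper_triangular_def)

lemma entry_summable: "(\<lambda>p. norm (entry m (fst p) (snd p))) summable_on A"
proof -
  have "(\<lambda>p. norm (entry m (fst p) (snd p))) summable_on UNIV"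
    using entry[of m] by (simp add: upper_triangular_def split_def)
  thus ?thesis by (rule summable_on_subset_banach) simp
qed

instantiation UP :: (linorder, complex_normed_vector) complex_vector
begin

lift_definition zero_UP :: "('a::linorder, 'b::complex_normed_vector) UP" is "\<lambda>_ _. 0"
  by (simp add: upper_triangular_def split_def)

lift_definition plus_UP :: "('a::linorder, 'b::complex_normed_vector) UP \<Rightarrow> ('a, 'b) UP \<Rightarrow> ('a, 'b) UP"
  is "\<lambda>m n i j. m i j + n i j"
proof -
  fix m n :: "'a \<Rightarrow> 'a \<Rightarrow> 'b" assume mn: "upper_triangular m" "upper_triangular n"
  have "(\<lambda>p. norm (m (fst p) (snd p) + n (fst p) (snd p))) summable_on UNIV"
    by (rule summable_on_comparison_test[OF summable_on_add[where f = "\<lambda>p. norm (m (fst p) (snd p))"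
          and g = "\<lambda>p. norm (n (fst p) (snd p))"]])
       (use mn norm_triangle_ineq in \<open>auto simp: upper_triangular_def split_def\<close>)
  thus "upper_triangular (\<lambda>i j. m i j + n i j)"
    using mn by (simp add: upper_triangular_def split_def)
qed

lift_definition uminus_UP :: "('a::linorder, 'b::complex_normed_vector) UP \<Rightarrow> ('a, 'b) UP"
  is "\<lambda>m i j. - m i j"
  by (simp add: upper_triangular_def)

definition minus_UP :: "('a::linorder, 'b::complex_normed_vector) UP \<Rightarrow> ('a, 'b) UP \<Rightarrow> ('a, 'b) UP"
  where "minus_UP m n = m + - n"

lift_definition scaleC_UP :: "complex \<Rightarrow> ('a::linorder, 'b::complex_normed_vector) UP \<Rightarrow> ('a, 'b) UP"
  is "\<lambda>c m i j. c *\<^sub>C m i j"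
  by (simp add: upper_triangular_def norm_scaleC split_def summable_on_cmult_right)

instance
proof
  fix m n k :: "('a, 'b) UP" and c d :: complex
  show "m + n + k = m + (n + k)" by transfer (simp add: add.assoc)
  show "m + n = n + m" by transfer (simp add: add.commute)
  show "0 + m = m" by transfer simp
  show "- m + m = 0" by transfer simp
  show "m - n = m + - n" by (rule minus_UP_def)
  show "c *\<^sub>C (m + n) = c *\<^sub>C m + c *\<^sub>C n" by transfer (simp add: scaleC_add_right)
  show "(c + d) *\<^sub>C m = c *\<^sub>C m + d *\<^sub>C m" by transfer (simp add: scaleC_add_left)
  show "c *\<^sub>C d *\<^sub>C m = (c * d) *\<^sub>C m" by transfer (simp add: scaleC_scaleC)
  show "1 *\<^sub>C m = m" by transfer (simp add: scaleC_one)
qed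

end

lemma entry_simps [simp]:
  "entry 0 i j = 0" "entry (a + b) i j = entry a i j + entry b i j"
  "entry (- a) i j = - entry a i j" "entry (a - b) i j = entry a i j - entry b i j"
  "entry (c *\<^sub>C a) i j = c *\<^sub>C entry a i j"
  unfolding minus_UP_def zero_UP.rep_eq plus_UP.rep_eq uminus_UP.rep_eq scaleC_UP.rep_eq by simp_all

lemma UP_eqI: "(\<And>i j. entry a i j = entry b i j) \<Longrightarrow> a = b"
  by (simp add: entry_inject[symmetric] fun_eq_iff)

instantiation UP :: (linorder, complex_normed_vector) real_vector
begin

definition scaleR_UP :: "real \<Rightarrow> ('a::linorder, 'b::complex_normed_vector) UP \<Rightarrow> ('a, 'b) UP"
  where "scaleR_UP r m = complex_of_real r *\<^sub>C m"

instance
  by standard (simp_all add: scaleR_UP_def scaleC_add_right scaleC_add_left scaleC_scaleC scaleC_one)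

end

instantiation UP :: (linorder, complex_normed_vector) real_normed_vector
begin

definition norm_UP :: "('a::linorder, 'b::complex_normed_vector) UP \<Rightarrow> real"
  where "norm_UP m = (\<Sum>\<^sub>\<infinity>(i, j). norm (entry m i j))"

definition sgn_UP :: "('a::linorder, 'b::complex_normed_vector) UP \<Rightarrow> ('a, 'b) UP"
  where "sgn_UP x = x /\<^sub>R norm x"

definition dist_UP :: "('a::linorder, 'b::complex_normed_vector) UP \<Rightarrow> ('a, 'b) UP \<Rightarrow> real"
  where "dist_UP x y = norm (x - y)"

definition uniformity_UP :: "(('a::linorder, 'b::complex_normed_vector) UP \<times> ('a, 'b) UP) filter"
  where [code del]: "uniformity_UP = (INF e\<in>{0<..}. principal {(x, y). dist x y < e})"

definition open_UP :: "('a::linorder, 'b::complex_normed_vector) UP set \<Rightarrow> bool"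
  where [code del]: "open_UP U \<longleftrightarrow> (\<forall>x\<in>U. eventually (\<lambda>(x', y). x' = x \<longrightarrow> y \<in> U) uniformity)"

lemma norm_UP_eq: "norm m = (\<Sum>\<^sub>\<infinity>p. norm (entry m (fst p) (snd p)))"
  for m :: "('a, 'b) UP"
  by (simp add: norm_UP_def split_def)

lemma sum_norm_entry_le: "finite F \<Longrightarrow> (\<Sum>p\<in>F. norm (entry m (fst p) (snd p))) \<le> norm m"
  for m :: "('a, 'b) UP"
  unfolding norm_UP_eq by (rule finite_sum_le_infsum[OF entry_summable]) auto

lemma norm_UP_le:
  assumes "\<And>F. finite F \<Longrightarrow> (\<Sum>p\<in>F. norm (entry m (fst p) (snd p))) \<le> B"
  shows "norm m \<le> B"
  unfolding norm_UP_eq by (rule infsum_le_finite_sums[OF entry_summable assms])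

lemma norm_entry_le: "norm (entry m i j) \<le> norm m"
  for m :: "('a, 'b) UP"
  using sum_norm_entry_le[of "{(i, j)}" m] by simp

lemma norm_scaleC_UP: "norm (r *\<^sub>C m) = cmod r * norm (m :: ('a, 'b) UP)"
  by (simp add: norm_UP_eq norm_scaleC infsum_cmult_right[OF entry_summable])

instance
proof
  fix a b :: "('a, 'b) UP" and p :: real
  show "sgn a = a /\<^sub>R norm a" by (rule sgn_UP_def)
  show "dist a b = norm (a - b)" by (rule dist_UP_def)
  show "uniformity = (INF e\<in>{0<..}. principal {(x :: ('a, 'b) UP, y). dist x y < e})"
    by (rule uniformity_UP_def)
  show "open U \<longleftrightarrow> (\<forall>x\<in>U. eventually (\<lambda>(x', y). x' = x \<longrightarrow> y \<in> U) uniformity)"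
    for U :: "('a, 'b) UP set" by (rule open_UP_def)
  show "norm a = 0 \<longleftrightarrow> a = 0"
  proof
    assume "norm a = 0"
    hence "norm (entry a i j) \<le> 0" for i j using norm_entry_le[of a i j] by simp
    thus "a = 0" by (intro UP_eqI) simp
  qed (simp add: norm_UP_eq)
  show "norm (a + b) \<le> norm a + norm b"
  proof (rule norm_UP_le)
    fix F :: "('a \<times> 'a) set" assume F: "finite F"
    have "(\<Sum>p\<in>F. norm (entry (a + b) (fst p) (snd p)))
        \<le> (\<Sum>p\<in>F. norm (entry a (fst p) (snd p)) + norm (entry b (fst p) (snd p)))"
      by (intro sum_mono) (simp add: norm_triangle_ineq)
    thus "(\<Sum>p\<in>F. norm (entry (a + b) (fst p) (snd p))) \<le> norm a + norm b"
      using sum_norm_entry_le[OF F, of a] sum_norm_entry_le[OF F, of b] by (simp add: sum.distrib)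
  qed
  show "norm (p *\<^sub>R a) = \<bar>p\<bar> * norm a"
    by (simp add: scaleR_UP_def norm_scaleC_UP)
qed

end

instance UP :: (linorder, complex_normed_vector) complex_normed_vector
  by standard (rule scaleR_UP_def norm_scaleC_UP)+

instance UP :: (linorder, complex_banach) complex_banach
proof
  fix X :: "nat \<Rightarrow> ('a, 'b) UP"
  assume X: "Cauchy X"
  have "Cauchy (\<lambda>n. entry (X n) i j)" for i j
  proof (rule CauchyI)
    fix e :: real assume "0 < e"
    then obtain N where N: "\<And>m n. m \<ge> N \<Longrightarrow> n \<ge> N \<Longrightarrow> norm (X m - X n) < e"
      using CauchyD[OF X] by blast
    have "norm (entry (X m) i j - entry (X n) i j) < e" if "m \<ge> N" "n \<ge> N" for m n
      using norm_entry_le[of "X m - X n" i j] N[OF that] by simp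
    thus "\<exists>M. \<forall>m\<ge>M. \<forall>n\<ge>M. norm (entry (X m) i j - entry (X n) i j) < e" by blast
  qed
  hence conv: "convergent (\<lambda>n. entry (X n) i j)" for i j
    by (intro Cauchy_convergent)
  define l where "l i j = lim (\<lambda>n. entry (X n) i j)" for i j
  have l: "(\<lambda>n. entry (X n) i j) \<longlonglongrightarrow> l i j" for i j
    using conv[of i j] by (simp add: l_def convergent_LIMSEQ_iff)
  have bound: "\<exists>N. \<forall>n\<ge>N. \<forall>F. finite F \<longrightarrow>
      (\<Sum>p\<in>F. norm (entry (X n) (fst p) (snd p) - l (fst p) (snd p))) \<le> e" if "0 < e" for e
  proof -
    obtain N where N: "\<And>m n. m \<ge> N \<Longrightarrow> n \<ge> N \<Longrightarrow> norm (X m - X n) < e"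
      using CauchyD[OF X \<open>0 < e\<close>] by blast
    have "(\<Sum>p\<in>F. norm (entry (X n) (fst p) (snd p) - l (fst p) (snd p))) \<le> e"
      if "n \<ge> N" "finite F" for n F
    proof (rule LIMSEQ_le_const2)
      show "(\<lambda>m. \<Sum>p\<in>F. norm (entry (X n) (fst p) (snd p) - entry (X m) (fst p) (snd p)))
          \<longlonglongrightarrow> (\<Sum>p\<in>F. norm (entry (X n) (fst p) (snd p) - l (fst p) (snd p)))"
        by (intro tendsto_intros l)
      show "\<exists>M. \<forall>m\<ge>M. (\<Sum>p\<in>F. norm (entry (X n) (fst p) (snd p) - entry (X m) (fst p) (snd p))) \<le> e"
      proof (intro exI[of _ N] allI impI)
        fix m assume "N \<le> m"
        thus "(\<Sum>p\<in>F. norm (entry (X n) (fst p) (snd p) - entry (X m) (fst p) (snd p))) \<le> e"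
          using sum_norm_entry_le[OF \<open>finite F\<close>, of "X n - X m"] N[OF \<open>n \<ge> N\<close>, of m] by simp
      qed
    qed
    thus ?thesis by blast
  qed
  obtain N where N: "\<And>F. finite F \<Longrightarrow>
      (\<Sum>p\<in>F. norm (entry (X N) (fst p) (snd p) - l (fst p) (snd p))) \<le> 1"
    using bound[of 1] by auto
  have "upper_triangular l"
    unfolding upper_triangular_def split_def
  proof (intro conjI allI impI)
    fix i j :: 'a assume "\<not> i \<le> j"
    thus "l i j = 0" using l[of i j] by (simp add: entry_lower LIMSEQ_const_iff)
  next
    show "(\<lambda>p. norm (l (fst p) (snd p))) summable_on UNIV"
    proof (rule summable_on_bounded_nonneg)
      fix F :: "('a \<times> 'a) set" assume F: "finite F"
      have "(\<Sum>p\<in>F. norm (l (fst p) (snd p))) \<le> (\<Sum>p\<in>F. norm (entry (X N) (fst p) (snd p))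
          + norm (entry (X N) (fst p) (snd p) - l (fst p) (snd p)))"
      proof (rule sum_mono)
        show "norm (l (fst p) (snd p)) \<le> norm (entry (X N) (fst p) (snd p))
          + norm (entry (X N) (fst p) (snd p) - l (fst p) (snd p))" for p
          using norm_triangle_ineq4[of "entry (X N) (fst p) (snd p)"
              "entry (X N) (fst p) (snd p) - l (fst p) (snd p)"] by simp
      qed
      also have "\<dots> \<le> norm (X N) + 1"
        using sum_norm_entry_le[OF F, of "X N"] N[OF F] by (simp add: sum.distrib)
      finally show "(\<Sum>p\<in>F. norm (l (fst p) (snd p))) \<le> norm (X N) + 1" .
    qed simp
  qed
  then obtain L where L: "entry L = l" using UP_inverse by auto
  have "X \<longlonglongrightarrow> L"
  proof (rule LIMSEQ_I)
    fix e :: real assume "0 < e"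
    then obtain N where "\<forall>n\<ge>N. \<forall>F. finite F \<longrightarrow>
        (\<Sum>p\<in>F. norm (entry (X n) (fst p) (snd p) - l (fst p) (snd p))) \<le> e / 2"
      using bound[of "e / 2"] by auto
    hence *: "norm (X n - L) \<le> e / 2" if "n \<ge> N" for n
      using that by (intro norm_UP_le) (simp add: L)
    have "norm (X n - L) < e" if "n \<ge> N" for n
      using *[OF that] \<open>0 < e\<close> by linarith
    thus "\<exists>N. \<forall>n\<ge>N. norm (X n - L) < e" by blast
  qed
  thus "convergent X" by (auto simp: convergent_def)
qed

text \<open>The triples \<open>(i, k, j)\<close> index the summands of the product of two matrices.\<close>

lemma UP_product_sum_le:
  fixes a b :: "('i::linorder, 'a::complex_normed_vector) UP"
  assumes "finite F"
  shows "(\<Sum>t\<in>F. norm (entry a (fst (fst t)) (snd t)) * norm (entry b (snd t) (snd (fst t))))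
    \<le> norm a * norm b"
proof -
  let ?A = "\<lambda>p. norm (entry a (fst p) (snd p))" and ?B = "\<lambda>p. norm (entry b (fst p) (snd p))"
  let ?h = "\<lambda>t :: ('i \<times> 'i) \<times> 'i. ((fst (fst t), snd t), (snd t, snd (fst t)))"
  have inj: "inj_on ?h F" by (auto simp: inj_on_def prod_eq_iff)
  let ?P = "fst ` ?h ` F" and ?Q = "snd ` ?h ` F"
  have fin: "finite ?P" "finite ?Q" using assms by auto
  have "(\<Sum>t\<in>F. norm (entry a (fst (fst t)) (snd t)) * norm (entry b (snd t) (snd (fst t))))
      = (\<Sum>x\<in>?h ` F. ?A (fst x) * ?B (snd x))"
    by (simp add: sum.reindex[OF inj])
  also have "\<dots> \<le> (\<Sum>x\<in>?P \<times> ?Q. ?A (fst x) * ?B (snd x))"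
  proof (rule sum_mono2)
    show "finite (?P \<times> ?Q)" using fin by blast
    show "?h ` F \<subseteq> ?P \<times> ?Q" by force
  qed auto
  also have "\<dots> = sum ?A ?P * sum ?B ?Q"
    by (simp add: sum_product sum.cartesian_product split_def)
  also have "\<dots> \<le> norm a * norm b"
    by (intro mult_mono sum_norm_entry_le fin sum_nonneg) auto
  finally show ?thesis .
qed

lemma UP_product_summable:
  fixes a b :: "('i::linorder, 'a::complex_normed_vector) UP"
  shows "(\<lambda>t. norm (entry a (fst (fst t)) (snd t)) * norm (entry b (snd t) (snd (fst t)))) summable_on UNIV"
    and "(\<Sum>\<^sub>\<infinity>t. norm (entry a (fst (fst t)) (snd t)) * norm (entry b (snd t) (snd (fst t))))
      \<le> norm a * norm b"
  by (rule summable_on_bounded_nonneg[where B = "norm a * norm b"]; simp add: UP_product_sum_le)+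

lemma UP_product_summable_entry:
  fixes a b :: "('i::linorder, 'a::complex_normed_vector) UP"
  shows "(\<lambda>j. norm (entry a i j) * norm (entry b j k)) summable_on UNIV"
proof -
  have "inj (\<lambda>j. ((i, k), j))" by (simp add: inj_on_def)
  from summable_on_reindex[OF this, of "\<lambda>t. norm (entry a (fst (fst t)) (snd t)) * norm (entry b (snd t) (snd (fst t)))"]
    summable_on_subset_banach[OF UP_product_summable(1)[of a b], of "range (\<lambda>j. ((i, k), j))"]
  show ?thesis by (simp add: o_def)
qed

lemma UP_product_abs_summable:
  fixes a b :: "('i::linorder, 'a::complex_banach_algebra) UP"
  shows "(\<lambda>j. norm (entry a i j * entry b j k)) summable_on UNIV"
    and "(\<lambda>j. entry a i j * entry b j k) summable_on UNIV"
proof -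
  show *: "(\<lambda>j. norm (entry a i j * entry b j k)) summable_on UNIV"
    by (rule summable_on_comparison_test[OF UP_product_summable_entry[of a i b k]])
       (simp_all add: norm_mult_ineq)
  show "(\<lambda>j. entry a i j * entry b j k) summable_on UNIV"
    by (rule abs_summable_summable[OF *])
qed

lemma UP_product_entry_le:
  fixes a b :: "('i::linorder, 'a::complex_banach_algebra) UP"
  shows "norm (\<Sum>\<^sub>\<infinity>j. entry a i j * entry b j k) \<le> (\<Sum>\<^sub>\<infinity>j. norm (entry a i j) * norm (entry b j k))"
proof -
  have "norm (\<Sum>\<^sub>\<infinity>j. entry a i j * entry b j k) \<le> (\<Sum>\<^sub>\<infinity>j. norm (entry a i j * entry b j k))"
    by (rule norm_infsum_bound[OF UP_product_abs_summable(1)])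
  also have "\<dots> \<le> (\<Sum>\<^sub>\<infinity>j. norm (entry a i j) * norm (entry b j k))"
    by (rule infsum_mono[OF UP_product_abs_summable(1) UP_product_summable_entry norm_mult_ineq])
  finally show ?thesis .
qed

lemma UP_product_summable_pairs:
  fixes a b :: "('i::linorder, 'a::complex_banach_algebra) UP"
  shows "(\<lambda>p. norm (\<Sum>\<^sub>\<infinity>j. entry a (fst p) j * entry b j (snd p))) summable_on UNIV"
    and "(\<Sum>\<^sub>\<infinity>p. norm (\<Sum>\<^sub>\<infinity>j. entry a (fst p) j * entry b j (snd p))) \<le> norm a * norm b"
proof -
  let ?f = "\<lambda>t. norm (entry a (fst (fst t)) (snd t)) * norm (entry b (snd t) (snd (fst t)))"
  have s: "?f summable_on (UNIV \<times> UNIV)" using UP_product_summable(1)[of a b] by simp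
  have 1: "(\<lambda>p. \<Sum>\<^sub>\<infinity>j. ?f (p, j)) summable_on UNIV" by (rule summable_on_Sigma_banach) (use s in \<open>simp add: split_def\<close>)
  show 2: "(\<lambda>p. norm (\<Sum>\<^sub>\<infinity>j. entry a (fst p) j * entry b j (snd p))) summable_on UNIV"
    by (rule summable_on_comparison_test[OF 1]) (simp_all add: UP_product_entry_le)
  have "(\<Sum>\<^sub>\<infinity>p. norm (\<Sum>\<^sub>\<infinity>j. entry a (fst p) j * entry b j (snd p))) \<le> (\<Sum>\<^sub>\<infinity>p. \<Sum>\<^sub>\<infinity>j. ?f (p, j))"
    by (rule infsum_mono[OF 2 1]) (simp add: UP_product_entry_le)
  also have "\<dots> = infsum ?f (UNIV \<times> UNIV)" by (rule infsum_Sigma_banach[OF s])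
  also have "\<dots> \<le> norm a * norm b" using UP_product_summable(2)[of a b] by simp
  finally show "(\<Sum>\<^sub>\<infinity>p. norm (\<Sum>\<^sub>\<infinity>j. entry a (fst p) j * entry b j (snd p))) \<le> norm a * norm b" .
qed

instantiation UP :: (linorder, complex_banach_algebra) complex_banach_algebra
begin

definition times_UP ::
    "('a::linorder, 'b::complex_banach_algebra) UP \<Rightarrow> ('a, 'b) UP \<Rightarrow> ('a, 'b) UP"
  where "times_UP a b = UP (\<lambda>i k. \<Sum>\<^sub>\<infinity>j. entry a i j * entry b j k)"

lemma entry_mult: "entry (a * b) i k = (\<Sum>\<^sub>\<infinity>j. entry a i j * entry b j k)"
  for a b :: "('a, 'b) UP"
proof -
  have "upper_triangular (\<lambda>i k. \<Sum>\<^sub>\<infinity>j. entry a i j * entry b j k)"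
    unfolding upper_triangular_def split_def
  proof (intro conjI allI impI)
    fix i k :: 'a assume ik: "\<not> i \<le> k"
    have "entry a i j * entry b j k = 0" for j
      using ik entry_lower[of i j a] entry_lower[of j k b] by (cases "i \<le> j") auto
    thus "(\<Sum>\<^sub>\<infinity>j. entry a i j * entry b j k) = 0" by simp
  qed (rule UP_product_summable_pairs)
  thus ?thesis by (simp add: times_UP_def UP_inverse)
qed

lemma UP_mult_assoc: "a * b * c = a * (b * c)" for a b c :: "('a, 'b) UP"
proof (rule UP_eqI)
  fix i l
  have *: "(\<lambda>(k, j). entry a i j * entry b j k * entry c k l) summable_on UNIV \<times> UNIV"
  proof (rule abs_summable_summable, rule summable_on_comparison_test)
    let ?f = "\<lambda>t. norm (entry a (fst (fst t)) (snd t)) * norm (entry b (snd t) (snd (fst t)))"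
    let ?h = "\<lambda>p :: 'a \<times> 'a. ((i, fst p), snd p)"
    have "inj ?h" by (auto simp: inj_on_def)
    from summable_on_reindex[OF this, of ?f] summable_on_subset_banach[OF UP_product_summable(1)[of a b], of "range ?h"]
    have "(\<lambda>p. norm (entry a i (snd p)) * norm (entry b (snd p) (fst p))) summable_on UNIV"
      by (simp add: o_def)
    thus "(\<lambda>p. norm (entry a i (snd p)) * norm (entry b (snd p) (fst p)) * norm c) summable_on UNIV \<times> UNIV"
      by (simp add: summable_on_cmult_left)
    show "norm (case p of (k, j) \<Rightarrow> entry a i j * entry b j k * entry c k l)
        \<le> norm (entry a i (snd p)) * norm (entry b (snd p) (fst p)) * norm c" for p
      unfolding split_def
      by (intro order_trans[OF norm_mult_ineq] mult_mono norm_mult_ineq norm_entry_le) auto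
  qed simp
  have "entry (a * b * c) i l = (\<Sum>\<^sub>\<infinity>k. \<Sum>\<^sub>\<infinity>j. entry a i j * entry b j k * entry c k l)"
    by (simp add: entry_mult infsum_cmult_left[OF UP_product_abs_summable(2)])
  also have "\<dots> = (\<Sum>\<^sub>\<infinity>j. \<Sum>\<^sub>\<infinity>k. entry a i j * entry b j k * entry c k l)"
    by (rule infsum_swap_banach[OF *])
  also have "\<dots> = entry (a * (b * c)) i l"
    by (simp add: entry_mult mult.assoc infsum_cmult_right[OF UP_product_abs_summable(2)])
  finally show "entry (a * b * c) i l = entry (a * (b * c)) i l" .
qed

lemma UP_scaleC_infsum:
  fixes f :: "'c \<Rightarrow> 'b" assumes "f summable_on UNIV"
  shows "(\<Sum>\<^sub>\<infinity>x. c *\<^sub>C f x) = c *\<^sub>C (\<Sum>\<^sub>\<infinity>x. f x)"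
proof (rule infsumI, rule has_sum_bounded_linear[OF _ has_sum_infsum[OF assms]])
  show "bounded_linear (\<lambda>x :: 'b. c *\<^sub>C x)"
    using bounded_clinearI[of "\<lambda>x :: 'b. c *\<^sub>C x" "cmod c"]
    by (simp add: bounded_clinear_def clinear_iff scaleC_add_right scaleC_scaleC norm_scaleC mult.commute)
qed

instance
proof
  fix a b c :: "('a, 'b) UP" and z :: complex and r :: real
  note s = UP_product_abs_summable(2)
  show "a * b * c = a * (b * c)" by (rule UP_mult_assoc)
  show "(a + b) * c = a * c + b * c"
    by (rule UP_eqI) (simp add: entry_mult distrib_right infsum_add[OF s s])
  show "a * (b + c) = a * b + a * c"
    by (rule UP_eqI) (simp add: entry_mult distrib_left infsum_add[OF s s])
  show 1: "(z *\<^sub>C a) * b = z *\<^sub>C (a * b)" for z and a b :: "('a, 'b) UP"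
    by (rule UP_eqI) (simp add: entry_mult mult_scaleC_left UP_scaleC_infsum[OF s])
  show 2: "a * (z *\<^sub>C b) = z *\<^sub>C (a * b)" for z and a b :: "('a, 'b) UP"
    by (rule UP_eqI) (simp add: entry_mult mult_scaleC_right UP_scaleC_infsum[OF s])
  show "(r *\<^sub>R a) * b = r *\<^sub>R (a * b)" "a * (r *\<^sub>R b) = r *\<^sub>R (a * b)"
    by (simp_all add: scaleR_scaleC 1 2)
  show "norm (a * b) \<le> norm a * norm b"
    using UP_product_summable_pairs(2)[of a b] by (simp add: norm_UP_eq entry_mult)
qed

end


section \<open>Characters and approximate biprojectivity\<close>

definition character_space :: "('a::complex_banach_algebra \<Rightarrow> complex) set"
  where "character_space =
    {\<phi>. clinear \<phi> \<and> (\<forall>x y. \<phi> (x * y) = \<phi> x * \<phi> y) \<and> \<phi> \<noteq> (\<lambda>_. 0)}"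

lemma bounded_cbilinear_mult: "bounded_cbilinear ((*) :: 'a::complex_banach_algebra \<Rightarrow> _)"
  by (rule bounded_cbilinearI[where K = 1])
     (simp_all add: clinear_iff distrib_left distrib_right mult_scaleC_left mult_scaleC_right norm_mult_ineq)

definition tensor_lact ::
    "'a::complex_banach_algebra \<Rightarrow> ('a, 'a) ptensor \<Rightarrow> ('a, 'a) ptensor"
  where "tensor_lact a = ptensor_lift (\<lambda>b c. (a * b) \<otimes>\<^sub>p c)"

definition tensor_ract ::
    "('a, 'a) ptensor \<Rightarrow> 'a::complex_banach_algebra \<Rightarrow> ('a, 'a) ptensor"
  where "tensor_ract t a = ptensor_lift (\<lambda>b c. b \<otimes>\<^sub>p (c * a)) t"

definition tensor_product_map :: "('a::complex_banach_algebra, 'a) ptensor \<Rightarrow> 'a"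
  where "tensor_product_map = ptensor_lift (*)"

lemma tensor_product_map:
  "bounded_clinear tensor_product_map" "tensor_product_map (b \<otimes>\<^sub>p c) = b * c"
  unfolding tensor_product_map_def by (rule ptensor_lift[OF bounded_cbilinear_mult])+

lemma tensor_lact:
  "bounded_clinear (tensor_lact a)" "tensor_lact a (b \<otimes>\<^sub>p c) = (a * b) \<otimes>\<^sub>p c"
proof -
  have "bounded_cbilinear (\<lambda>(b :: 'a) (c :: 'a). (a * b) \<otimes>\<^sub>p c)"
  proof (rule bounded_cbilinearI[where K = "norm a"])
    fix b c :: 'a
    have "norm ((a * b) \<otimes>\<^sub>p c) \<le> norm (a * b) * norm c" by (rule norm_ptensor_le)
    also have "\<dots> \<le> (norm a * norm b) * norm c" by (intro mult_right_mono norm_mult_ineq) simp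
    finally show "norm ((a * b) \<otimes>\<^sub>p c) \<le> norm b * norm c * norm a" by (simp add: mult_ac)
  qed (simp_all add: clinear_iff ptensor_bilinear distrib_left mult_scaleC_right)
  from ptensor_lift[OF this]
  show "bounded_clinear (tensor_lact a)" "tensor_lact a (b \<otimes>\<^sub>p c) = (a * b) \<otimes>\<^sub>p c"
    unfolding tensor_lact_def .
qed

lemma tensor_ract:
  "bounded_clinear (\<lambda>t. tensor_ract t a)" "tensor_ract (b \<otimes>\<^sub>p c) a = b \<otimes>\<^sub>p (c * a)"
proof -
  have "bounded_cbilinear (\<lambda>(b :: 'a) (c :: 'a). b \<otimes>\<^sub>p (c * a))"
  proof (rule bounded_cbilinearI[where K = "norm a"])
    fix b c :: 'a
    have "norm (b \<otimes>\<^sub>p (c * a)) \<le> norm b * norm (c * a)" by (rule norm_ptensor_le)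
    also have "\<dots> \<le> norm b * (norm c * norm a)" by (intro mult_left_mono norm_mult_ineq) simp
    finally show "norm (b \<otimes>\<^sub>p (c * a)) \<le> norm b * norm c * norm a" by (simp add: mult_ac)
  qed (simp_all add: clinear_iff ptensor_bilinear distrib_right mult_scaleC_left)
  from ptensor_lift[OF this]
  show "bounded_clinear (\<lambda>t. tensor_ract t a)" "tensor_ract (b \<otimes>\<^sub>p c) a = b \<otimes>\<^sub>p (c * a)"
    unfolding tensor_ract_def .
qed

definition bimodule_morphism :: "('a::complex_banach_algebra \<Rightarrow> ('a, 'a) ptensor) \<Rightarrow> bool"
  where "bimodule_morphism \<rho> \<longleftrightarrow> bounded_clinear \<rho> \<and>
    (\<forall>a b. \<rho> (a * b) = tensor_lact a (\<rho> b)) \<and> (\<forall>a b. \<rho> (a * b) = tensor_ract (\<rho> a) b)"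

definition directed_preorder :: "'n set \<Rightarrow> ('n \<Rightarrow> 'n \<Rightarrow> bool) \<Rightarrow> bool"
  where "directed_preorder D le \<longleftrightarrow> D \<noteq> {} \<and> (\<forall>x\<in>D. le x x) \<and>
    (\<forall>x\<in>D. \<forall>y\<in>D. \<forall>z\<in>D. le x y \<longrightarrow> le y z \<longrightarrow> le x z) \<and>
    (\<forall>x\<in>D. \<forall>y\<in>D. \<exists>z\<in>D. le x z \<and> le y z)"

definition approximating_net ::
    "'n set \<Rightarrow> ('n \<Rightarrow> 'n \<Rightarrow> bool) \<Rightarrow> ('n \<Rightarrow> 'a::complex_banach_algebra \<Rightarrow> ('a, 'a) ptensor) \<Rightarrow> bool"
  where "approximating_net D le \<rho> \<longleftrightarrow> directed_preorder D le \<and>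
    (\<forall>\<alpha>\<in>D. bimodule_morphism (\<rho> \<alpha>)) \<and>
    (\<forall>a. \<forall>e>0. \<exists>\<alpha>\<^sub>0\<in>D. \<forall>\<alpha>\<in>D. le \<alpha>\<^sub>0 \<alpha> \<longrightarrow> norm (tensor_product_map (\<rho> \<alpha> a) - a) < e)"

text \<open>A definition cannot quantify over the index type of the net. The one fixed here is large
  enough: by \<open>approx_biprojectiveI\<close> below, a net over any index type can be replaced by one
  over this type.\<close>

definition approx_biprojective :: "'a::complex_banach_algebra itself \<Rightarrow> bool"
  where "approx_biprojective (_ :: 'a itself) \<longleftrightarrow>
    (\<exists>(D :: ('a set \<times> nat) set) le (\<rho> :: _ \<Rightarrow> 'a \<Rightarrow> ('a, 'a) ptensor). approximating_net D le \<rho>)"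

lemma approx_biprojectiveI:
  fixes \<rho> :: "'n \<Rightarrow> 'a::complex_banach_algebra \<Rightarrow> ('a, 'a) ptensor"
  assumes "approximating_net D le \<rho>"
  shows "approx_biprojective TYPE('a)"
proof -
  have D: "directed_preorder D le" and mor: "\<And>\<alpha>. \<alpha> \<in> D \<Longrightarrow> bimodule_morphism (\<rho> \<alpha>)"
    and lim: "\<And>a e. 0 < e \<Longrightarrow>
      \<exists>\<alpha>\<^sub>0\<in>D. \<forall>\<alpha>\<in>D. le \<alpha>\<^sub>0 \<alpha> \<longrightarrow> norm (tensor_product_map (\<rho> \<alpha> a) - a) < e"
    using assms by (auto simp: approximating_net_def)
  have ev: "\<exists>\<alpha>\<^sub>0\<in>D. \<forall>\<alpha>\<in>D. le \<alpha>\<^sub>0 \<alpha> \<longrightarrow> (\<forall>a\<in>F. norm (tensor_product_map (\<rho> \<alpha> a) - a) < e)"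
    if "finite F" "0 < e" for F e
    using that
  proof (induction F rule: finite_induct)
    case empty
    then show ?case using D unfolding directed_preorder_def by blast
  next
    case (insert a F)
    obtain x where x: "x \<in> D"
      "\<forall>\<alpha>\<in>D. le x \<alpha> \<longrightarrow> (\<forall>a\<in>F. norm (tensor_product_map (\<rho> \<alpha> a) - a) < e)"
      using insert.IH[OF insert.prems] by blast
    obtain y where y: "y \<in> D" "\<forall>\<alpha>\<in>D. le y \<alpha> \<longrightarrow> norm (tensor_product_map (\<rho> \<alpha> a) - a) < e"
      using lim[OF \<open>0 < e\<close>] by blast
    obtain z where z: "z \<in> D" "le x z" "le y z"
      using D x(1) y(1) unfolding directed_preorder_def by blast
    have "le x \<alpha> \<and> le y \<alpha>" if "\<alpha> \<in> D" "le z \<alpha>" for \<alpha>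
      using D that x(1) y(1) z unfolding directed_preorder_def by blast
    thus ?case using x(2) y(2) z(1) by (intro bexI[of _ z] ballI impI) blast+
  qed
  have "\<exists>\<alpha>\<in>D. finite (fst p) \<longrightarrow>
      (\<forall>a\<in>fst p. norm (tensor_product_map (\<rho> \<alpha> a) - a) < inverse (real (Suc (snd p))))"
    for p :: "'a set \<times> nat"
  proof (cases "finite (fst p)")
    case True
    have "0 < inverse (real (Suc (snd p)))" by simp
    from ev[OF True this] obtain x where x: "x \<in> D" "\<forall>\<alpha>\<in>D. le x \<alpha> \<longrightarrow>
        (\<forall>a\<in>fst p. norm (tensor_product_map (\<rho> \<alpha> a) - a) < inverse (real (Suc (snd p))))" ..
    moreover have "le x x" using D x(1) unfolding directed_preorder_def by blast
    ultimately show ?thesis by blast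
  next
    case False
    then show ?thesis using D unfolding directed_preorder_def by blast
  qed
  then obtain \<beta> where \<beta>: "\<And>p. \<beta> p \<in> D" "\<And>p a. finite (fst p) \<Longrightarrow> a \<in> fst p \<Longrightarrow>
      norm (tensor_product_map (\<rho> (\<beta> p) a) - a) < inverse (real (Suc (snd p)))"
  proof -
    assume that: "\<And>\<beta> :: 'a set \<times> nat \<Rightarrow> 'n. (\<And>p. \<beta> p \<in> D) \<Longrightarrow> (\<And>p a. finite (fst p) \<Longrightarrow> a \<in> fst p \<Longrightarrow>
      norm (tensor_product_map (\<rho> (\<beta> p) a) - a) < inverse (real (Suc (snd p)))) \<Longrightarrow> thesis"
    assume "\<And>p :: 'a set \<times> nat. \<exists>\<alpha>\<in>D. finite (fst p) \<longrightarrow>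
      (\<forall>a\<in>fst p. norm (tensor_product_map (\<rho> \<alpha> a) - a) < inverse (real (Suc (snd p))))"
    hence "\<exists>\<beta>. \<forall>p :: 'a set \<times> nat. \<beta> p \<in> D \<and> (finite (fst p) \<longrightarrow>
      (\<forall>a\<in>fst p. norm (tensor_product_map (\<rho> (\<beta> p) a) - a) < inverse (real (Suc (snd p)))))"
      by (intro choice) blast
    thus thesis using that by blast
  qed
  let ?D = "{p :: 'a set \<times> nat. finite (fst p)}"
  let ?le = "\<lambda>p q :: 'a set \<times> nat. fst p \<subseteq> fst q \<and> snd p \<le> snd q"
  have "approximating_net ?D ?le (\<lambda>p. \<rho> (\<beta> p))"
    unfolding approximating_net_def
  proof (intro conjI ballI allI impI)
    show "directed_preorder ?D ?le"
      unfolding directed_preorder_def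
    proof (intro conjI ballI)
      have "({}, 0) \<in> ?D" by simp
      thus "?D \<noteq> {}" by blast
      fix p q assume "p \<in> ?D" "q \<in> ?D"
      thus "\<exists>r\<in>?D. ?le p r \<and> ?le q r"
        by (intro bexI[of _ "(fst p \<union> fst q, max (snd p) (snd q))"]) auto
    qed auto
    show "bimodule_morphism (\<rho> (\<beta> p))" for p by (rule mor[OF \<beta>(1)])
    fix a and e :: real assume "0 < e"
    then obtain k where k: "inverse (real (Suc k)) < e" using reals_Archimedean by blast
    have "norm (tensor_product_map (\<rho> (\<beta> p) a) - a) < e" if "p \<in> ?D" "?le ({a}, k) p" for p
    proof -
      have "norm (tensor_product_map (\<rho> (\<beta> p) a) - a) < inverse (real (Suc (snd p)))"
        by (rule \<beta>(2)) (use that in auto)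
      also have "\<dots> \<le> inverse (real (Suc k))" using that by (intro le_imp_inverse_le) auto
      finally show ?thesis using k by simp
    qed
    thus "\<exists>p0\<in>?D. \<forall>p\<in>?D. ?le p0 p \<longrightarrow> norm (tensor_product_map (\<rho> (\<beta> p) a) - a) < e"
      by (intro bexI[of _ "({a}, k)"]) auto
  qed
  thus ?thesis unfolding approx_biprojective_def by blast
qed

end

theory Submission
  imports Defs
begin

text \<open>
  Suppose that \<open>I\<close> has a least element \<open>o\<close> and a further element \<open>i > o\<close>, and that \<open>e\<close> is a
  non-zero idempotent of \<open>A\<close>; a right identity is one as soon as \<open>A\<close> is non-zero. Write
  \<open>E k l\<close> for the matrix whose only non-zero entry is \<open>e\<close>, at place \<open>(k, l)\<close>. The element
  \<open>E o i = E o i * E i i = E o o * E o i\<close> is a product in two ways, so every bimodule morphism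
  \<open>\<rho>\<close> satisfies \<open>\<rho> (E o i) = E o i \<cdot> \<rho> (E i i) = \<rho> (E o o) \<cdot> E o i\<close>. By the first form, the left
  tensor factors in \<open>\<rho> (E o i)\<close> have zero entry at \<open>(o, o)\<close>: they are multiples \<open>E o i * b\<close>, and the
  row \<open>i\<close> of \<open>b\<close> is zero in column \<open>o < i\<close>. By the second form, the right tensor factors
  are multiples \<open>c * E o i\<close>; since column \<open>o\<close> of \<open>c\<close> lives in row \<open>o\<close> alone, so does column \<open>i\<close>
  of \<open>c * E o i\<close>. The \<open>(o, i)\<close> entry of a product of such factors is the entry at \<open>(o, o)\<close> of the
  left one times the entry at \<open>(o, i)\<close> of the right one, hence zero. So the image of \<open>E o i\<close> under
  \<open>\<pi> \<circ> \<rho>\<close> stays at distance at least \<open>norm e\<close> from \<open>E o i\<close>, for every \<open>\<rho>\<close>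
  (\<open>bimodule_morphism_corner_zero\<close>), and no net \<open>\<rho>\<close> as in the definition of approximate
  biprojectivity exists.

  The two conditions on \<open>\<rho> (E o i)\<close> hold for different representations of it, so the argument cannot
  be run on elementary tensors directly. It is run through the functional
  \<open>b \<otimes> c \<mapsto> b o o * c o i\<close>, which vanishes on \<open>E o i \<cdot> t\<close> for all \<open>t\<close> and agrees with the
  \<open>(o, i)\<close> entry of \<open>\<pi>\<close> on \<open>t \<cdot> E o i\<close> for all \<open>t\<close>.

  If \<open>I\<close> is a singleton, \<open>UP(I, A)\<close> is isomorphic to \<open>A\<close>, and approximate biprojectivity is carried
  along an isomorphism \<open>\<Phi>\<close> by conjugating each \<open>\<rho>\<close> with \<open>\<Phi>\<close> and \<open>\<Phi> \<otimes> \<Phi>\<close>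
  (\<open>approx_biprojective_transfer\<close>).
\<close>

section \<open>Bounded linear maps\<close>

lemma clinear_compose: "clinear f \<Longrightarrow> clinear g \<Longrightarrow> clinear (\<lambda>x. f (g x))"
  by (simp add: clinear_iff)

lemma bounded_clinear_compose:
  "bounded_clinear f \<Longrightarrow> bounded_clinear g \<Longrightarrow> bounded_clinear (\<lambda>x. f (g x))"
  unfolding bounded_clinear_def by (blast intro: clinear_compose bounded_linear_compose)

lemma bounded_clinear_zero: "bounded_clinear (\<lambda>_. 0)"
  by (rule bounded_clinearI[where K = 0]) (simp_all add: clinear_iff)

lemma bounded_clinear_bound:
  assumes "bounded_clinear f"
  obtains K where "0 \<le> K" "\<And>x. norm (f x) \<le> norm x * K"
  using assms bounded_linear.nonneg_bounded unfolding bounded_clinear_def by blast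

lemma bounded_cbilinear_compose:
  assumes f: "bounded_cbilinear f" and g: "bounded_clinear g" and h: "bounded_clinear h"
  shows "bounded_cbilinear (\<lambda>x y. f (g x) (h y))"
proof -
  have "bounded_bilinear (\<lambda>x y. f (g x) (h y))"
    using f g h unfolding bounded_cbilinear_def bounded_clinear_def
    by (blast intro: bounded_bilinear.comp)
  moreover have "clinear (\<lambda>y. f (g x) (h y))" "clinear (\<lambda>x. f (g x) (h y))" for x y
    using clinear_compose[of "f (g x)" h] clinear_compose[of "\<lambda>x. f x (h y)" g] f g h
    unfolding bounded_cbilinear_def bounded_clinear_def by blast+
  ultimately show ?thesis unfolding bounded_cbilinear_def by blast
qed

section \<open>Transfer along isomorphisms\<close>

definition ptensor_map ::
    "('a::complex_normed_vector \<Rightarrow> 'c::complex_normed_vector) \<Rightarrow>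
     ('b::complex_normed_vector \<Rightarrow> 'd::complex_normed_vector) \<Rightarrow>
     ('a, 'b) ptensor \<Rightarrow> ('c, 'd) ptensor"
  where "ptensor_map f g = ptensor_lift (\<lambda>x y. f x \<otimes>\<^sub>p g y)"

lemma ptensor_map:
  assumes "bounded_clinear f" "bounded_clinear g"
  shows "bounded_clinear (ptensor_map f g)" and "ptensor_map f g (x \<otimes>\<^sub>p y) = f x \<otimes>\<^sub>p g y"
  unfolding ptensor_map_def
  by (rule ptensor_lift[OF bounded_cbilinear_compose[OF bounded_cbilinear_ptensor assms]])+

lemma ptensor_map_hom:
  fixes \<Phi> :: "'a::complex_banach_algebra \<Rightarrow> 'b::complex_banach_algebra"
  assumes \<Phi>: "bounded_clinear \<Phi>" and mult: "\<And>x y. \<Phi> (x * y) = \<Phi> x * \<Phi> y"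
  shows "ptensor_map \<Phi> \<Phi> (tensor_lact a t) = tensor_lact (\<Phi> a) (ptensor_map \<Phi> \<Phi> t)"
    and "ptensor_map \<Phi> \<Phi> (tensor_ract t a) = tensor_ract (ptensor_map \<Phi> \<Phi> t) (\<Phi> a)"
    and "tensor_product_map (ptensor_map \<Phi> \<Phi> t) = \<Phi> (tensor_product_map t)"
proof -
  note T = ptensor_map[OF \<Phi> \<Phi>]
  have "(\<lambda>t. ptensor_map \<Phi> \<Phi> (tensor_lact a t)) = (\<lambda>t. tensor_lact (\<Phi> a) (ptensor_map \<Phi> \<Phi> t))"
    by (rule bounded_clinear_ptensor_ext)
       (simp_all add: T(2) tensor_lact(2) mult
         bounded_clinear_compose[OF T(1) tensor_lact(1)] bounded_clinear_compose[OF tensor_lact(1) T(1)])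
  thus "ptensor_map \<Phi> \<Phi> (tensor_lact a t) = tensor_lact (\<Phi> a) (ptensor_map \<Phi> \<Phi> t)"
    by (rule fun_cong)
  have "(\<lambda>t. ptensor_map \<Phi> \<Phi> (tensor_ract t a)) = (\<lambda>t. tensor_ract (ptensor_map \<Phi> \<Phi> t) (\<Phi> a))"
    by (rule bounded_clinear_ptensor_ext)
       (simp_all add: T(2) tensor_ract(2) mult
         bounded_clinear_compose[OF T(1) tensor_ract(1)] bounded_clinear_compose[OF tensor_ract(1) T(1)])
  thus "ptensor_map \<Phi> \<Phi> (tensor_ract t a) = tensor_ract (ptensor_map \<Phi> \<Phi> t) (\<Phi> a)"
    by (rule fun_cong)
  have "(\<lambda>t. tensor_product_map (ptensor_map \<Phi> \<Phi> t)) = (\<lambda>t. \<Phi> (tensor_product_map t))"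
    by (rule bounded_clinear_ptensor_ext)
       (simp_all add: T(2) tensor_product_map(2) mult bounded_clinear_compose[OF tensor_product_map(1) T(1)]
         bounded_clinear_compose[OF \<Phi> tensor_product_map(1)])
  thus "tensor_product_map (ptensor_map \<Phi> \<Phi> t) = \<Phi> (tensor_product_map t)"
    by (rule fun_cong)
qed

text \<open>The map \<open>\<Phi> \<otimes> \<Phi>\<close> turns an \<open>A\<close>-bimodule morphism \<open>\<rho>\<close> into the \<open>B\<close>-bimodule morphism
  \<open>(\<Phi> \<otimes> \<Phi>) \<circ> \<rho> \<circ> \<Psi>\<close>, and it intertwines the product maps. Hence the error of the new net at \<open>b\<close>
  is the image under \<open>\<Phi>\<close> of the error of the old one at \<open>\<Psi> b\<close>.\<close>

lemma approx_biprojective_transfer: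
  fixes \<Phi> :: "'a::complex_banach_algebra \<Rightarrow> 'b::complex_banach_algebra"
  assumes \<Phi>: "bounded_clinear \<Phi>" and \<Psi>: "bounded_clinear \<Psi>"
    and mult: "\<And>x y. \<Phi> (x * y) = \<Phi> x * \<Phi> y"
    and inv: "\<And>x. \<Psi> (\<Phi> x) = x" "\<And>y. \<Phi> (\<Psi> y) = y"
    and A: "approx_biprojective TYPE('a)"
  shows "approx_biprojective TYPE('b)"
proof -
  obtain D le \<rho> where net: "approximating_net (D :: ('a set \<times> nat) set) le (\<rho> :: _ \<Rightarrow> 'a \<Rightarrow> _)"
    using A unfolding approx_biprojective_def by blast
  have \<Psi>_mult: "\<Psi> (x * y) = \<Psi> x * \<Psi> y" for x y
    by (metis inv mult)
  let ?\<rho> = "\<lambda>\<alpha> b. ptensor_map \<Phi> \<Phi> (\<rho> \<alpha> (\<Psi> b))"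
  have "approximating_net D le ?\<rho>"
    unfolding approximating_net_def
  proof (intro conjI ballI allI impI)
    show "directed_preorder D le" using net by (simp add: approximating_net_def)
    fix \<alpha> assume "\<alpha> \<in> D"
    hence "bimodule_morphism (\<rho> \<alpha>)" using net by (simp add: approximating_net_def)
    hence \<rho>: "bounded_clinear (\<rho> \<alpha>)" "\<rho> \<alpha> (x * y) = tensor_lact x (\<rho> \<alpha> y)"
      "\<rho> \<alpha> (x * y) = tensor_ract (\<rho> \<alpha> x) y" for x y
      by (auto simp only: bimodule_morphism_def)
    show "bimodule_morphism (?\<rho> \<alpha>)"
      unfolding bimodule_morphism_def
    proof (intro conjI allI)
      show "bounded_clinear (?\<rho> \<alpha>)"
        by (intro bounded_clinear_compose[OF ptensor_map(1)[OF \<Phi> \<Phi>]]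
            bounded_clinear_compose[OF \<rho>(1)] \<Psi>)
      fix a b
      show "?\<rho> \<alpha> (a * b) = tensor_lact a (?\<rho> \<alpha> b)"
        by (simp only: \<Psi>_mult \<rho>(2) ptensor_map_hom(1)[OF \<Phi> mult] inv)
      show "?\<rho> \<alpha> (a * b) = tensor_ract (?\<rho> \<alpha> a) b"
        by (simp only: \<Psi>_mult \<rho>(3) ptensor_map_hom(2)[OF \<Phi> mult] inv)
    qed
  next
    fix b and \<epsilon> :: real assume "0 < \<epsilon>"
    obtain K where K: "0 \<le> K" "\<And>x. norm (\<Phi> x) \<le> norm x * K"
      by (rule bounded_clinear_bound[OF \<Phi>]) blast
    have pos: "0 < \<epsilon> / (K + 1)" using \<open>0 < \<epsilon>\<close> K(1) by simp
    have "\<forall>\<delta>>0. \<exists>\<alpha>\<^sub>0\<in>D. \<forall>\<alpha>\<in>D. le \<alpha>\<^sub>0 \<alpha> \<longrightarrow>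
        norm (tensor_product_map (\<rho> \<alpha> (\<Psi> b)) - \<Psi> b) < \<delta>"
      using net by (simp add: approximating_net_def)
    with pos obtain \<alpha>\<^sub>0 where \<alpha>\<^sub>0: "\<alpha>\<^sub>0 \<in> D" "\<And>\<alpha>. \<alpha> \<in> D \<Longrightarrow> le \<alpha>\<^sub>0 \<alpha> \<Longrightarrow>
        norm (tensor_product_map (\<rho> \<alpha> (\<Psi> b)) - \<Psi> b) < \<epsilon> / (K + 1)"
      by blast
    have "norm (tensor_product_map (?\<rho> \<alpha> b) - b) < \<epsilon>" if "\<alpha> \<in> D" "le \<alpha>\<^sub>0 \<alpha>" for \<alpha>
    proof -
      let ?d = "tensor_product_map (\<rho> \<alpha> (\<Psi> b)) - \<Psi> b"
      have "clinear \<Phi>" using \<Phi> by (simp add: bounded_clinear_def)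
      hence "tensor_product_map (?\<rho> \<alpha> b) - b = \<Phi> ?d"
        by (simp add: ptensor_map_hom(3)[OF \<Phi> mult] clinearD(5) inv)
      hence "norm (tensor_product_map (?\<rho> \<alpha> b) - b) \<le> norm ?d * (K + 1)"
        using K(2)[of ?d] by (simp add: distrib_left add_increasing2)
      also have "\<dots> < \<epsilon>" using \<alpha>\<^sub>0(2)[OF that] K(1) by (simp add: field_simps)
      finally show ?thesis .
    qed
    thus "\<exists>\<alpha>\<^sub>0\<in>D. \<forall>\<alpha>\<in>D. le \<alpha>\<^sub>0 \<alpha> \<longrightarrow> norm (tensor_product_map (?\<rho> \<alpha> b) - b) < \<epsilon>"
      using \<alpha>\<^sub>0(1) by blast
  qed
  thus ?thesis by (rule approx_biprojectiveI)
qed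

section \<open>Matrices with a single entry\<close>

text \<open>A single entry below the diagonal is replaced by zero, so that the matrix is upper triangular for
  all \<open>k\<close> and \<open>l\<close>.\<close>

definition single_entry :: "'i::linorder \<Rightarrow> 'i \<Rightarrow> 'a::complex_normed_vector \<Rightarrow> ('i, 'a) UP"
  where "single_entry k l a = UP (\<lambda>i j. if i = k \<and> j = l \<and> k \<le> l then a else 0)"

lemma entry_single_entry:
  "entry (single_entry k l a) i j = (if i = k \<and> j = l \<and> k \<le> l then a else 0)"
proof -
  have "(\<lambda>p. norm (if fst p = k \<and> snd p = l \<and> k \<le> l then a else 0)) summable_on UNIV"
    using summable_on_finite[of "{(k, l)}" "\<lambda>p. norm (if fst p = k \<and> snd p = l \<and> k \<le> l then a else 0)"]
    by (rule summable_on_cong_neutral[THEN iffD1, rotated -1]) (auto simp: prod_eq_iff)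
  hence "upper_triangular (\<lambda>i j. if i = k \<and> j = l \<and> k \<le> l then a else 0)"
    by (auto simp: upper_triangular_def split_def)
  thus ?thesis by (simp add: single_entry_def UP_inverse)
qed

lemma bounded_clinear_entry: "bounded_clinear (\<lambda>m :: ('i::linorder, 'a::complex_normed_vector) UP. entry m i j)"
  by (rule bounded_clinearI[where K = 1]) (simp_all add: clinear_iff norm_entry_le)

lemma infsum_single_index:
  fixes f :: "'b \<Rightarrow> 'c::{comm_monoid_add, t2_space}"
  assumes "\<And>j. j \<noteq> k \<Longrightarrow> f j = 0"
  shows "(\<Sum>\<^sub>\<infinity>j. f j) = f k"
proof -
  have "(\<Sum>\<^sub>\<infinity>j. f j) = infsum f {k}" by (rule infsum_cong_neutral) (use assms in auto)
  thus ?thesis by simp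
qed

lemma entry_mult_single_entry:
  fixes a :: "('i::linorder, 'a::complex_banach_algebra) UP"
  assumes "k \<le> l"
  shows "entry (a * single_entry k l x) i j = (if j = l then entry a i k * x else 0)"
    and "entry (single_entry k l x * a) i j = (if i = k then x * entry a l j else 0)"
  unfolding entry_mult
  by (subst infsum_single_index[of k]; use assms in \<open>simp add: entry_single_entry\<close>)
     (subst infsum_single_index[of l]; use assms in \<open>simp add: entry_single_entry\<close>)

lemma single_entry_mult:
  assumes "k \<le> l" "l \<le> m"
  shows "single_entry k l x * single_entry l m y = single_entry k m (x * y)"
  by (rule UP_eqI) (use assms in \<open>auto simp: entry_mult_single_entry entry_single_entry\<close>)

text \<open>In the product at a diagonal place \<open>(i, i)\<close> only the middle index \<open>i\<close> survives, by
  triangularity; so taking a diagonal entry is multiplicative.\<close>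

lemma entry_mult_diagonal: "entry (a * b) i i = entry a i i * entry b i i"
  unfolding entry_mult
proof (rule infsum_single_index)
  fix j assume "j \<noteq> i"
  hence "\<not> i \<le> j \<or> \<not> j \<le> i" by auto
  thus "entry a i j * entry b j i = 0"
  proof
    assume "\<not> i \<le> j" thus ?thesis by (simp add: entry_lower)
  next
    assume "\<not> j \<le> i" thus ?thesis by (simp add: entry_lower)
  qed
qed

section \<open>The obstruction from a second index\<close>

text \<open>Since \<open>e\<close> is idempotent, \<open>E = E * E\<^sub>i\<^sub>i = E\<^sub>o\<^sub>o * E\<close> for the matrix \<open>E\<close> with entry \<open>e\<close> at \<open>(o, i)\<close>.
  The first factorisation makes \<open>\<rho> E\<close> a left multiple of \<open>E\<close> and the second a right multiple;
  a tensor that is both has a product whose \<open>(o, i)\<close> entry is zero.\<close>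

lemma bimodule_morphism_corner_zero:
  fixes o\<^sub>I i :: "'i::linorder" and e :: "'a::complex_banach_algebra"
  assumes \<rho>: "bimodule_morphism \<rho>" and least: "\<And>j. o\<^sub>I \<le> j" and "o\<^sub>I < i" and idem: "e * e = e"
  shows "entry (tensor_product_map (\<rho> (single_entry o\<^sub>I i e))) o\<^sub>I i = 0"
proof -
  define E where "E = single_entry o\<^sub>I i e"
  let ?f = "\<lambda>b c :: ('i, 'a) UP. entry b o\<^sub>I o\<^sub>I * entry c o\<^sub>I i"
  have f: "bounded_cbilinear ?f"
    by (intro bounded_cbilinear_compose[OF bounded_cbilinear_mult] bounded_clinear_entry)
  note F = ptensor_lift[OF f]
  have le: "o\<^sub>I \<le> i" and lower: "entry b i o\<^sub>I = 0" for b :: "('i, 'a) UP"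
    using \<open>o\<^sub>I < i\<close> by (auto simp: entry_lower)
  note E = entry_mult_single_entry[OF le, where x = e, folded E_def]
  have "(\<lambda>t. ptensor_lift ?f (tensor_lact E t)) = (\<lambda>_. 0)"
    by (rule bounded_clinear_ptensor_ext)
       (simp_all add: F(2) tensor_lact(2) E lower
         bounded_clinear_compose[OF F(1) tensor_lact(1)] bounded_clinear_zero)
  hence left: "ptensor_lift ?f (tensor_lact E t) = 0" for t by (rule fun_cong)
  \<comment> \<open>Right multiplication by \<open>E\<close> moves column \<open>o\<close>, times \<open>e\<close>, to column \<open>i\<close>; so the multiplicativity of the entry at
    \<open>(o, o)\<close> becomes a statement about the entry at \<open>(o, i)\<close>.\<close>
  have tensors: "entry (b * (c * E)) o\<^sub>I i = ?f b (c * E)" for b c :: "('i, 'a) UP"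
    by (simp add: mult.assoc[symmetric] E entry_mult_diagonal)
  have "(\<lambda>t. entry (tensor_product_map (tensor_ract t E)) o\<^sub>I i) = (\<lambda>t. ptensor_lift ?f (tensor_ract t E))"
    by (rule bounded_clinear_ptensor_ext)
       (simp_all add: F(2) tensor_ract(2) tensor_product_map(2) tensors
         bounded_clinear_compose[OF F(1) tensor_ract(1)] bounded_clinear_compose[OF bounded_clinear_entry
           bounded_clinear_compose[OF tensor_product_map(1) tensor_ract(1)]])
  hence right: "entry (tensor_product_map (tensor_ract t E)) o\<^sub>I i = ptensor_lift ?f (tensor_ract t E)"
    for t by (rule fun_cong)
  have "E = single_entry o\<^sub>I o\<^sub>I e * E" "E = E * single_entry i i e"
    by (simp_all add: E_def single_entry_mult le idem)
  hence "\<rho> E = tensor_ract (\<rho> (single_entry o\<^sub>I o\<^sub>I e)) E" "\<rho> E = tensor_lact E (\<rho> (single_entry i i e))"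
    using \<rho> unfolding bimodule_morphism_def by metis+
  thus ?thesis using left right by (metis E_def)
qed

lemma UP_not_approx_biprojective:
  fixes o\<^sub>I i :: "'i::linorder" and e :: "'a::complex_banach_algebra"
  assumes least: "\<And>j. o\<^sub>I \<le> j" and "o\<^sub>I < i" and "e * e = e" "e \<noteq> 0"
  shows "\<not> approx_biprojective TYPE(('i, 'a) UP)"
proof
  let ?E = "single_entry o\<^sub>I i e"
  assume "approx_biprojective TYPE(('i, 'a) UP)"
  then obtain D le \<rho> where net:
      "approximating_net (D :: (('i, 'a) UP set \<times> nat) set) le (\<rho> :: _ \<Rightarrow> ('i, 'a) UP \<Rightarrow> _)"
    unfolding approx_biprojective_def by blast
  have "0 < norm e" using \<open>e \<noteq> 0\<close> by simp
  with net obtain \<alpha> where \<alpha>: "\<alpha> \<in> D"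
      "\<forall>\<beta>\<in>D. le \<alpha> \<beta> \<longrightarrow> norm (tensor_product_map (\<rho> \<beta> ?E) - ?E) < norm e"
    unfolding approximating_net_def by blast
  moreover have "le \<alpha> \<alpha>" "bimodule_morphism (\<rho> \<alpha>)"
    using net \<alpha>(1) by (auto simp: approximating_net_def directed_preorder_def)
  ultimately have "norm (tensor_product_map (\<rho> \<alpha> ?E) - ?E) < norm e" by blast
  moreover have "norm (entry (tensor_product_map (\<rho> \<alpha> ?E) - ?E) o\<^sub>I i) = norm e"
    using bimodule_morphism_corner_zero[OF \<open>bimodule_morphism (\<rho> \<alpha>)\<close> least \<open>o\<^sub>I < i\<close> \<open>e * e = e\<close>]
      \<open>o\<^sub>I < i\<close> by (simp add: entry_single_entry less_imp_le)
  ultimately show False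
    using norm_entry_le[of "tensor_product_map (\<rho> \<alpha> ?E) - ?E" o\<^sub>I i] by simp
qed

section \<open>One by one matrices\<close>

lemma UP_singleton_approx_biprojective_iff:
  fixes o\<^sub>I :: "'i::linorder"
  assumes only: "\<And>j. j = o\<^sub>I"
  shows "approx_biprojective TYPE(('i, 'a::complex_banach_algebra) UP) \<longleftrightarrow> approx_biprojective TYPE('a)"
proof -
  let ?\<Phi> = "\<lambda>a :: 'a. single_entry o\<^sub>I o\<^sub>I a" and ?\<Psi> = "\<lambda>m :: ('i, 'a) UP. entry m o\<^sub>I o\<^sub>I"
  have inv: "?\<Psi> (?\<Phi> a) = a" "?\<Phi> (?\<Psi> m) = m" for a m
  proof -
    show "?\<Psi> (?\<Phi> a) = a" by (simp add: entry_single_entry)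
    show "?\<Phi> (?\<Psi> m) = m"
    proof (rule UP_eqI)
      fix i j
      show "entry (?\<Phi> (?\<Psi> m)) i j = entry m i j"
        unfolding only[of i] only[of j] by (simp add: entry_single_entry)
    qed
  qed
  have \<Phi>: "bounded_clinear ?\<Phi>"
  proof (rule bounded_clinearI[where K = 1])
    show "clinear ?\<Phi>"
      unfolding clinear_iff by (auto intro!: UP_eqI simp: entry_single_entry)
    fix a :: 'a
    have "(\<Sum>\<^sub>\<infinity>p. norm (entry (?\<Phi> a) (fst p) (snd p))) = norm a"
      by (subst infsum_single_index[of "(o\<^sub>I, o\<^sub>I)"]) (auto simp: entry_single_entry prod_eq_iff)
    thus "norm (?\<Phi> a) \<le> norm a * 1" by (simp add: norm_UP_eq)
  qed
  have "?\<Psi> (m * n) = ?\<Psi> m * ?\<Psi> n" for m n by (rule entry_mult_diagonal)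
  moreover have "?\<Phi> (a * b) = ?\<Phi> a * ?\<Phi> b" for a b by (simp add: single_entry_mult)
  ultimately show ?thesis
    using approx_biprojective_transfer[of ?\<Phi> ?\<Psi>] approx_biprojective_transfer[of ?\<Psi> ?\<Phi>]
      \<Phi> bounded_clinear_entry[of o\<^sub>I o\<^sub>I] inv by blast
qed

theorem theorem3p1:
  assumes "\<exists>i\<^sub>0 :: 'i::linorder. \<forall>i. i\<^sub>0 \<le> i"
    and "\<exists>e :: 'a::complex_banach_algebra. \<forall>a. a * e = a"
    and "(character_space :: ('a \<Rightarrow> complex) set) \<noteq> {}"
  shows "approx_biprojective TYPE(('i, 'a) UP) \<longleftrightarrow>
    is_singleton (UNIV :: 'i set) \<and> approx_biprojective TYPE('a)"
proof -
  obtain o\<^sub>I :: 'i where least: "\<And>j. o\<^sub>I \<le> j" using assms(1) by blast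
  obtain e :: 'a where e: "\<And>a. a * e = a" using assms(2) by blast
  obtain \<phi> :: "'a \<Rightarrow> complex" where "clinear \<phi>" "\<phi> \<noteq> (\<lambda>_. 0)"
    using assms(3) by (auto simp: character_space_def)
  then obtain a where "\<phi> a \<noteq> \<phi> 0" using clinearD(3)[of \<phi>] by fastforce
  hence "a \<noteq> 0" by blast
  hence "e \<noteq> 0" using e[of a] by auto
  show ?thesis
  proof (cases "\<forall>j. j = o\<^sub>I")
    case True
    hence "(UNIV :: 'i set) = {o\<^sub>I}" by blast
    hence "is_singleton (UNIV :: 'i set)" unfolding is_singleton_def by blast
    thus ?thesis using UP_singleton_approx_biprojective_iff[of o\<^sub>I] True by blast
  next
    case False
    then obtain i where "i \<noteq> o\<^sub>I" by blast
    hence "o\<^sub>I < i" using least[of i] by simp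
    moreover have "\<not> is_singleton (UNIV :: 'i set)"
      using \<open>i \<noteq> o\<^sub>I\<close> by (metis UNIV_I is_singletonE singletonD)
    ultimately show ?thesis
      using UP_not_approx_biprojective[OF least _ e \<open>e \<noteq> 0\<close>] by blast
  qed
qed

end
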